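(* Let $x\in\mathcal C_{\varepsilon_1,\varepsilon_2}$ for some (small) $\varepsilon_1,\varepsilon_2>0$, and assume $\sigma$ satisfies $\sigma(b)>\alpha/\mu$ for all $b$ and $$\sigma(b)\ge \frac{\alpha}{\mu}\,\frac{\phi_k'(b)+\phi_{k-1}'(b)}{\phi_k'(b)-\phi_{k-1}'(b)},\qquad b\in\mathbb R,\ k=2,\dots,K.$$ Fix $b\in\mathbb R$, let the scale $a$ range over $[a_1(b),a_2(b)]$, and let $\tilde\epsilon_1>0$. With the notation of the context, the following hold. (a) Suppose $\tilde\epsilon_1\ge a_2(b)\sigma(b)\Lambda_1(b)+\tau_0\sum_{k=1}^K A_k(b)$. Then for every $(a,b)$ with $|\widetilde W_x(a,b)|>\tilde\epsilon_1$ there exists a unique $k\in\{1,\dots,K\}$ such that $(a,b)\in Z_k$. (b) For every $(a,b)$ with $\widetilde W_x(a,b)\neq0$ and every $k\in\{1,\dots,K\}$, $$\omega_x^{\rm adp,c}(a,b)-\phi_k'(b)=\frac{{\rm Rem}_1}{i2\pi\widetilde W_x(a,b)},$$ where $${\rm Rem}_1:=i2\pi\Big(\frac{\mu}{a}-\phi_k'(b)\Big){\rm rem}_0-\frac{{\rm rem}_0'}{a\sigma(b)}+i2\pi\sum_{\ell\ne k}x_\ell(b)\big(\phi_\ell'(b)-\phi_k'(b)\big)\widehat g\big(\sigma(b)(\mu-a\phi_\ell'(b))\big).$$ Hence, for $(a,b)$ satisfying $|\widetilde W_x(a,b)|>\tilde\epsilon_1$ and $(a,b)\in Z_k$, $$|\omega_x^{\rm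 adp}(a,b)-\phi_k'(b)|<{\rm bd}_k,$$ where $${\rm bd}_k:=\frac1{\tilde\epsilon_1}\Big(\alpha\Lambda_k(b)+\frac1{2\pi}\widetilde\Lambda_k(b)\Big)+\frac1{\tilde\epsilon_1}\sum_{\ell\neq k}A_\ell(b)\,|\phi_\ell'(b)-\phi_k'(b)|\,\big|\widehat g\big(\rho_{\ell,k}(b)\big)\big|.$$ (c) Let $k\in\{1,\dots,K\}$. Suppose $\tilde\epsilon_1$ satisfies the condition in (a) and $\max_{1\le\ell\le K}{\rm bd}_\ell\le\frac12L_k(b)$. Then for every $\tilde\epsilon_3$ with $\max_{1\le\ell\le K}{\rm bd}_\ell\le\tilde\epsilon_3\le\frac12L_k(b)$, $$\Big|\lim_{\lambda\to0^+}\frac1{c_\psi^\alpha(b)}\int_{|\xi-\phi_k'(b)|<\tilde\epsilon_3}T^{\rm adp,\lambda}_{x,\tilde\epsilon_1}(\xi,b)\,d\xi-x_k(b)\Big|\le\widetilde{\rm bd}_k,$$ where $$\widetilde{\rm bd}_k:=\frac1{|c_\psi^\alpha(b)|}\Big\{\tilde\epsilon_1\ln\frac{\mu\sigma(b)+\alpha}{\mu\sigma(b)-\alpha}+\frac{2\alpha}{\phi_k'(b)}\Lambda_k(b)+\sum_{\ell\ne k}A_\ell(b)\,|m_{\ell,k}(b)|\Big\},$$ $$m_{\ell,k}(b):=\int_{\mu-\alpha/\sigma(b)}^{\mu+\alpha/\sigma(b)}\widehat g\Big(\sigma(b)\Big(\mu-\frac{\phi_\ell'(b)}{\phi_k'(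b)}\xi\Big)\Big)\frac{d\xi}{\xi}.$$
   Context: Fourier transform: $\widehat f(\xi)=\int_{\mathbb R}f(t)e^{-i2\pi\xi t}dt$. Fixed data: $\mu>0$; $g$ in the Schwartz class; $\sigma:\mathbb R\to(0,\infty)$ differentiable. Numbers $\alpha>0$ and $\tau_0$: either (i) $|\widehat g|$ is even and decreasing on $[0,\infty)$, $\tau_0>0$ is a given small threshold and $\alpha$ is defined by $|\widehat g(\alpha)|=\tau_0$ (so $|\widehat g(\xi)|\le\tau_0$ for $|\xi|\ge\alpha$); or (ii) $\widehat g$ is supported in $[-\alpha,\alpha]$, in which case $\tau_0=0$. Signals: $\mathcal C_{\varepsilon_1,\varepsilon_2}$ is the set of $x(t)=\sum_{k=1}^Kx_k(t)$, $x_k(t)=A_k(t)e^{i2\pi\phi_k(t)}$, with real-valued $A_k\in C^1(\mathbb R)\cap L_\infty(\mathbb R)$, $\phi_k\in C^2(\mathbb R)$, $A_k(t)>0$, $\inf_t\phi_k'(t)>0$, $\sup_t\phi_k'(t)<\infty$, $\phi_{k-1}'(t)<\phi_k'(t)$ for $2\le k\le K$, $\inf_{2\le k\le K,\,t\in\mathbb R}\frac{\phi_k'(t)-\phi_{k-1}'(t)}{\phi_k'(t)+\phi_{k-1}'(t)}>0$, and $|A_k'(t)|\le\varepsilon_1$, $|\phi_k''(t)|\le\varepsilon_2$ for all $t$ and $1\le k\le K$. Adaptive CWT: for a Schwartz function $w$ and $a>0$, $\widetilde W^w_x(a,b):=\int_{\mathbb R}x(b+at)\frac1{\sigma(b)}w\big(\frac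 t{\sigma(b)}\big)e^{-i2\pi\mu t}dt$; $\widetilde W_x:=\widetilde W_x^g$ and $g_3(t):=tg'(t)$. Phase transformation (where $\widetilde W_x(a,b)\ne0$): $$\omega_x^{\rm adp,c}(a,b):=\frac{\partial_b\widetilde W_x(a,b)}{i2\pi\widetilde W_x(a,b)}+\frac{\sigma'(b)}{i2\pi\sigma(b)}+\frac{\sigma'(b)}{\sigma(b)}\frac{\widetilde W_x^{g_3}(a,b)}{i2\pi\widetilde W_x(a,b)},\qquad\omega_x^{\rm adp}:={\rm Re}\,\omega_x^{\rm adp,c}.$$ Scales are restricted to $a_1(b)\le a\le a_2(b)$, $a_1(b):=\frac{\mu-\alpha/\sigma(b)}{\phi_K'(b)}$, $a_2(b):=\frac{\mu+\alpha/\sigma(b)}{\phi_1'(b)}$. Adaptive WSST, for $\gamma,\lambda>0$ and a fixed continuous compactly supported $h$ with $\int_{\mathbb R}h=1$: $$T^{\rm adp,\lambda}_{x,\gamma}(\xi,b):=\int_{\{a\in[a_1(b),a_2(b)]:\,|\widetilde W_x(a,b)|>\gamma\}}\widetilde W_x(a,b)\frac1\lambda h\Big(\frac{\xi-\omega_x^{\rm adp}(a,b)}{\lambda}\Big)\frac{da}a.$$ Zones: $Z_k:=\{(a,b):|\mu-a\phi_k'(b)|<\alpha/\sigma(b),\,b\in\mathbb R\}$. Remainders: ${\rm rem}_0:=\widetilde W_x(a,b)-\sum_{k=1}^Kx_k(b)\widehat g\big(\sigma(b)(\mu-a\phi_k'(b))\big)$, and ${\rm rem}_0'$ is the same quantity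 with $g$ replaced by $g'$, i.e. ${\rm rem}_0':=\widetilde W_x^{g'}(a,b)-\sum_{k=1}^Kx_k(b)\widehat{(g')}\big(\sigma(b)(\mu-a\phi_k'(b))\big)$. Constants: $I_n:=\int_{\mathbb R}|t^ng(t)|dt$, $\widetilde I_n:=\int_{\mathbb R}|t^ng'(t)|dt$, $$\Lambda_k(b):=K\varepsilon_1I_1+\pi\varepsilon_2I_2\frac{\mu\sigma(b)+\alpha}{\phi_k'(b)}\sum_{j=1}^KA_j(b),\qquad\widetilde\Lambda_k(b):=K\varepsilon_1\widetilde I_1+\pi\varepsilon_2\widetilde I_2\frac{\mu\sigma(b)+\alpha}{\phi_k'(b)}\sum_{j=1}^KA_j(b).$$ $\rho_{\ell,k}(b):=\sigma(b)\mu-(\sigma(b)\mu+\alpha)\frac{\phi_\ell'(b)}{\phi_k'(b)}$ if $\ell<k$, and $\rho_{\ell,k}(b):=(\sigma(b)\mu-\alpha)\frac{\phi_\ell'(b)}{\phi_k'(b)}-\sigma(b)\mu$ if $\ell>k$. $L_k(b):=\min\{\phi_k'(b)-\phi_{k-1}'(b),\ \phi_{k+1}'(b)-\phi_k'(b)\}$, where terms involving the undefined $\phi_0'$ or $\phi_{K+1}'$ are omitted (minimum over the empty set is $+\infty$). $c_\psi^\alpha(b):=\int_{\mu-\alpha/\sigma(b)}^{\mu+\alpha/\sigma(b)}\widehat g\big(\sigma(b)(\mu-\xi)\big)\frac{d\xi}\xi$, assumed nonzero. $\sum_{\ell\ne k}$ means the sum over $\ell\in\{1,\dots,K\}\setminus\{k\}$.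 *)

theory Defs
  imports "HOL-Analysis.Analysis"
begin

definition fourier :: "(real \<Rightarrow> complex) \<Rightarrow> real \<Rightarrow> complex" where
  "fourier f \<xi> = (LBINT t. f t * exp (- (\<i> * complex_of_real (2 * pi * \<xi> * t))))"

definition vderiv :: "(real \<Rightarrow> complex) \<Rightarrow> real \<Rightarrow> complex" where
  "vderiv f t = vector_derivative f (at t)"

definition schwartz :: "(real \<Rightarrow> complex) \<Rightarrow> bool" where
  "schwartz f \<longleftrightarrow>
     (\<forall>n t. (vderiv ^^ n) f differentiable (at t)) \<and>
     (\<forall>m n. bounded (range (\<lambda>t. t ^ m *\<^sub>R (vderiv ^^ n) f t)))"

text \<open>The first alternative is a window whose spectrum exceeds the threshold \<open>\<tau>0\<close> at most
  on \<open>{-\<alpha><..<\<alpha>}\<close>, the second a band-limited window.  ``Decreasing'' is meant weakly.\<close>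

definition essential_bandwidth :: "(real \<Rightarrow> complex) \<Rightarrow> real \<Rightarrow> real \<Rightarrow> bool" where
  "essential_bandwidth g \<alpha> \<tau>0 \<longleftrightarrow> \<alpha> > 0 \<and>
     (((\<forall>\<xi>. cmod (fourier g (- \<xi>)) = cmod (fourier g \<xi>)) \<and>
       antimono_on {0..} (\<lambda>\<xi>. cmod (fourier g \<xi>)) \<and>
       \<tau>0 > 0 \<and> cmod (fourier g \<alpha>) = \<tau>0)
      \<or> (closure {\<xi>. fourier g \<xi> \<noteq> 0} \<subseteq> {-\<alpha>..\<alpha>} \<and> \<tau>0 = 0))"

text \<open>A signal is given by its number \<open>K\<close> of components, the amplitudes \<open>A k\<close> and the
  phases \<open>\<phi> k\<close>, where only the indices \<open>1 \<le> k \<le> K\<close> matter.  Infima and suprema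
  are taken in the extended reals, so that \<open>Inf {} = \<infinity>\<close>.\<close>

definition component :: "(nat \<Rightarrow> real \<Rightarrow> real) \<Rightarrow> (nat \<Rightarrow> real \<Rightarrow> real) \<Rightarrow> nat \<Rightarrow> real \<Rightarrow> complex" where
  "component A \<phi> k t = complex_of_real (A k t) * exp (\<i> * complex_of_real (2 * pi * \<phi> k t))"

definition signal :: "nat \<Rightarrow> (nat \<Rightarrow> real \<Rightarrow> real) \<Rightarrow> (nat \<Rightarrow> real \<Rightarrow> real) \<Rightarrow> real \<Rightarrow> complex" where
  "signal K A \<phi> t = (\<Sum>k=1..K. component A \<phi> k t)"

definition signal_class ::
  "real \<Rightarrow> real \<Rightarrow> nat \<Rightarrow> (nat \<Rightarrow> real \<Rightarrow> real) \<Rightarrow> (nat \<Rightarrow> real \<Rightarrow> real) \<Rightarrow> bool" where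
  "signal_class \<epsilon>1 \<epsilon>2 K A \<phi> \<longleftrightarrow> K \<ge> 1 \<and>
     (\<forall>k\<in>{1..K}.
        A k C1_differentiable_on UNIV \<and>
        (\<exists>C. AE t in lborel. \<bar>A k t\<bar> \<le> C) \<and>
        \<phi> k C1_differentiable_on UNIV \<and> deriv (\<phi> k) C1_differentiable_on UNIV \<and>
        (\<forall>t. A k t > 0) \<and>
        (INF t. ereal (deriv (\<phi> k) t)) > 0 \<and>
        (SUP t. ereal (deriv (\<phi> k) t)) < \<infinity> \<and>
        (\<forall>t. \<bar>deriv (A k) t\<bar> \<le> \<epsilon>1) \<and>
        (\<forall>t. \<bar>deriv (deriv (\<phi> k)) t\<bar> \<le> \<epsilon>2)) \<and>
     (\<forall>k\<in>{2..K}. \<forall>t. deriv (\<phi> (k - 1)) t < deriv (\<phi> k) t) \<and>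
     (INF (k, t)\<in>{2..K} \<times> UNIV.
        ereal ((deriv (\<phi> k) t - deriv (\<phi> (k - 1)) t) / (deriv (\<phi> k) t + deriv (\<phi> (k - 1)) t))) > 0"

definition acwt ::
  "real \<Rightarrow> (real \<Rightarrow> real) \<Rightarrow> (real \<Rightarrow> complex) \<Rightarrow> (real \<Rightarrow> complex) \<Rightarrow> real \<Rightarrow> real \<Rightarrow> complex" where
  "acwt \<mu> \<sigma> w x a b =
     (LBINT t. x (b + a * t) * complex_of_real (1 / \<sigma> b) * w (t / \<sigma> b)
               * exp (- (\<i> * complex_of_real (2 * pi * \<mu> * t))))"

text \<open>Only meaningful where the transform does not vanish (division by zero yields zero).\<close>

definition phase_c ::
  "real \<Rightarrow> (real \<Rightarrow> real) \<Rightarrow> (real \<Rightarrow> complex) \<Rightarrow> (real \<Rightarrow> complex) \<Rightarrow> real \<Rightarrow> real \<Rightarrow> complex" where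
  "phase_c \<mu> \<sigma> g x a b =
     (let W = acwt \<mu> \<sigma> g x a b; c = \<i> * complex_of_real (2 * pi) in
      vector_derivative (\<lambda>b'. acwt \<mu> \<sigma> g x a b') (at b) / (c * W)
      + complex_of_real (deriv \<sigma> b) / (c * complex_of_real (\<sigma> b))
      + complex_of_real (deriv \<sigma> b / \<sigma> b)
        * (acwt \<mu> \<sigma> (\<lambda>t. complex_of_real t * vderiv g t) x a b / (c * W)))"

definition phase ::
  "real \<Rightarrow> (real \<Rightarrow> real) \<Rightarrow> (real \<Rightarrow> complex) \<Rightarrow> (real \<Rightarrow> complex) \<Rightarrow> real \<Rightarrow> real \<Rightarrow> real" where
  "phase \<mu> \<sigma> g x a b = Re (phase_c \<mu> \<sigma> g x a b)"

definition scale_min :: "real \<Rightarrow> (real \<Rightarrow> real) \<Rightarrow> real \<Rightarrow> nat \<Rightarrow> (nat \<Rightarrow> real \<Rightarrow> real) \<Rightarrow> real \<Rightarrow> real" where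
  "scale_min \<mu> \<sigma> \<alpha> K \<phi> b = (\<mu> - \<alpha> / \<sigma> b) / deriv (\<phi> K) b"

definition scale_max :: "real \<Rightarrow> (real \<Rightarrow> real) \<Rightarrow> real \<Rightarrow> (nat \<Rightarrow> real \<Rightarrow> real) \<Rightarrow> real \<Rightarrow> real" where
  "scale_max \<mu> \<sigma> \<alpha> \<phi> b = (\<mu> + \<alpha> / \<sigma> b) / deriv (\<phi> 1) b"

definition awsst ::
  "real \<Rightarrow> (real \<Rightarrow> real) \<Rightarrow> (real \<Rightarrow> complex) \<Rightarrow> real \<Rightarrow> nat \<Rightarrow> (nat \<Rightarrow> real \<Rightarrow> real) \<Rightarrow> (nat \<Rightarrow> real \<Rightarrow> real) \<Rightarrow>
   (real \<Rightarrow> complex) \<Rightarrow> real \<Rightarrow> real \<Rightarrow> real \<Rightarrow> real \<Rightarrow> complex" where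
  "awsst \<mu> \<sigma> g \<alpha> K A \<phi> h \<gamma> lam \<xi> b =
     (let x = signal K A \<phi> in
      LBINT a:{a \<in> {scale_min \<mu> \<sigma> \<alpha> K \<phi> b .. scale_max \<mu> \<sigma> \<alpha> \<phi> b}. cmod (acwt \<mu> \<sigma> g x a b) > \<gamma>}.
        acwt \<mu> \<sigma> g x a b * complex_of_real (1 / lam) * h ((\<xi> - phase \<mu> \<sigma> g x a b) / lam)
        / complex_of_real a)"

definition zone :: "real \<Rightarrow> (real \<Rightarrow> real) \<Rightarrow> real \<Rightarrow> (nat \<Rightarrow> real \<Rightarrow> real) \<Rightarrow> nat \<Rightarrow> (real \<times> real) set" where
  "zone \<mu> \<sigma> \<alpha> \<phi> k = {(a, b). \<bar>\<mu> - a * deriv (\<phi> k) b\<bar> < \<alpha> / \<sigma> b}"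

text \<open>The window \<open>w\<close> is instantiated both with \<open>g\<close> and with its derivative:
  \<open>\<Lambda>\<^sub>k\<close> and \<open>rem\<^sub>0\<close> are \<open>err_bound\<close> and \<open>remainder\<close> at \<open>g\<close>, while their tilde and
  primed versions are \<open>err_bound\<close> and \<open>remainder\<close> at \<open>vderiv g\<close>.\<close>

definition remainder ::
  "real \<Rightarrow> (real \<Rightarrow> real) \<Rightarrow> nat \<Rightarrow> (nat \<Rightarrow> real \<Rightarrow> real) \<Rightarrow> (nat \<Rightarrow> real \<Rightarrow> real) \<Rightarrow>
   (real \<Rightarrow> complex) \<Rightarrow> real \<Rightarrow> real \<Rightarrow> complex" where
  "remainder \<mu> \<sigma> K A \<phi> w a b =
     acwt \<mu> \<sigma> w (signal K A \<phi>) a b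
     - (\<Sum>k=1..K. component A \<phi> k b * fourier w (\<sigma> b * (\<mu> - a * deriv (\<phi> k) b)))"

definition abs_moment :: "nat \<Rightarrow> (real \<Rightarrow> complex) \<Rightarrow> real" where
  "abs_moment n w = (LBINT t. cmod (complex_of_real (t ^ n) * w t))"

definition err_bound ::
  "real \<Rightarrow> (real \<Rightarrow> real) \<Rightarrow> real \<Rightarrow> real \<Rightarrow> real \<Rightarrow> nat \<Rightarrow> (nat \<Rightarrow> real \<Rightarrow> real) \<Rightarrow> (nat \<Rightarrow> real \<Rightarrow> real) \<Rightarrow>
   (real \<Rightarrow> complex) \<Rightarrow> nat \<Rightarrow> real \<Rightarrow> real" where
  "err_bound \<mu> \<sigma> \<alpha> \<epsilon>1 \<epsilon>2 K A \<phi> w k b =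
     real K * \<epsilon>1 * abs_moment 1 w
     + pi * \<epsilon>2 * abs_moment 2 w * ((\<mu> * \<sigma> b + \<alpha>) / deriv (\<phi> k) b) * (\<Sum>j=1..K. A j b)"

definition Rem1 ::
  "real \<Rightarrow> (real \<Rightarrow> real) \<Rightarrow> (real \<Rightarrow> complex) \<Rightarrow> nat \<Rightarrow> (nat \<Rightarrow> real \<Rightarrow> real) \<Rightarrow> (nat \<Rightarrow> real \<Rightarrow> real) \<Rightarrow>
   nat \<Rightarrow> real \<Rightarrow> real \<Rightarrow> complex" where
  "Rem1 \<mu> \<sigma> g K A \<phi> k a b =
     \<i> * complex_of_real (2 * pi) * complex_of_real (\<mu> / a - deriv (\<phi> k) b)
       * remainder \<mu> \<sigma> K A \<phi> g a b
     - remainder \<mu> \<sigma> K A \<phi> (vderiv g) a b / complex_of_real (a * \<sigma> b)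
     + \<i> * complex_of_real (2 * pi)
       * (\<Sum>l\<in>{1..K} - {k}. component A \<phi> l b * complex_of_real (deriv (\<phi> l) b - deriv (\<phi> k) b)
            * fourier g (\<sigma> b * (\<mu> - a * deriv (\<phi> l) b)))"

text \<open>Only used for \<open>l \<noteq> k\<close>.\<close>

definition rho ::
  "real \<Rightarrow> (real \<Rightarrow> real) \<Rightarrow> real \<Rightarrow> (nat \<Rightarrow> real \<Rightarrow> real) \<Rightarrow> nat \<Rightarrow> nat \<Rightarrow> real \<Rightarrow> real" where
  "rho \<mu> \<sigma> \<alpha> \<phi> l k b =
     (if l < k then \<sigma> b * \<mu> - (\<sigma> b * \<mu> + \<alpha>) * (deriv (\<phi> l) b / deriv (\<phi> k) b)
      else (\<sigma> b * \<mu> - \<alpha>) * (deriv (\<phi> l) b / deriv (\<phi> k) b) - \<sigma> b * \<mu>)"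

definition bd ::
  "real \<Rightarrow> (real \<Rightarrow> real) \<Rightarrow> (real \<Rightarrow> complex) \<Rightarrow> real \<Rightarrow> real \<Rightarrow> real \<Rightarrow>
   nat \<Rightarrow> (nat \<Rightarrow> real \<Rightarrow> real) \<Rightarrow> (nat \<Rightarrow> real \<Rightarrow> real) \<Rightarrow> real \<Rightarrow> nat \<Rightarrow> real \<Rightarrow> real" where
  "bd \<mu> \<sigma> g \<alpha> \<epsilon>1 \<epsilon>2 K A \<phi> e1 k b =
     1 / e1 * (\<alpha> * err_bound \<mu> \<sigma> \<alpha> \<epsilon>1 \<epsilon>2 K A \<phi> g k b
               + 1 / (2 * pi) * err_bound \<mu> \<sigma> \<alpha> \<epsilon>1 \<epsilon>2 K A \<phi> (vderiv g) k b)
     + 1 / e1 * (\<Sum>l\<in>{1..K} - {k}. A l b * \<bar>deriv (\<phi> l) b - deriv (\<phi> k) b\<bar>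
                    * cmod (fourier g (rho \<mu> \<sigma> \<alpha> \<phi> l k b)))"

definition freq_gap :: "nat \<Rightarrow> (nat \<Rightarrow> real \<Rightarrow> real) \<Rightarrow> nat \<Rightarrow> real \<Rightarrow> ereal" where
  "freq_gap K \<phi> k b =
     min (if 1 < k then ereal (deriv (\<phi> k) b - deriv (\<phi> (k - 1)) b) else \<infinity>)
         (if k < K then ereal (deriv (\<phi> (k + 1)) b - deriv (\<phi> k) b) else \<infinity>)"

definition c_psi :: "real \<Rightarrow> (real \<Rightarrow> real) \<Rightarrow> (real \<Rightarrow> complex) \<Rightarrow> real \<Rightarrow> real \<Rightarrow> complex" where
  "c_psi \<mu> \<sigma> g \<alpha> b =
     (LBINT \<xi>:{\<mu> - \<alpha> / \<sigma> b .. \<mu> + \<alpha> / \<sigma> b}.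
        fourier g (\<sigma> b * (\<mu> - \<xi>)) / complex_of_real \<xi>)"

definition cross_coeff ::
  "real \<Rightarrow> (real \<Rightarrow> real) \<Rightarrow> (real \<Rightarrow> complex) \<Rightarrow> real \<Rightarrow> (nat \<Rightarrow> real \<Rightarrow> real) \<Rightarrow> nat \<Rightarrow> nat \<Rightarrow> real \<Rightarrow> complex" where
  "cross_coeff \<mu> \<sigma> g \<alpha> \<phi> l k b =
     (LBINT \<xi>:{\<mu> - \<alpha> / \<sigma> b .. \<mu> + \<alpha> / \<sigma> b}.
        fourier g (\<sigma> b * (\<mu> - deriv (\<phi> l) b / deriv (\<phi> k) b * \<xi>)) / complex_of_real \<xi>)"

definition recovery_bd ::
  "real \<Rightarrow> (real \<Rightarrow> real) \<Rightarrow> (real \<Rightarrow> complex) \<Rightarrow> real \<Rightarrow> real \<Rightarrow> real \<Rightarrow>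
   nat \<Rightarrow> (nat \<Rightarrow> real \<Rightarrow> real) \<Rightarrow> (nat \<Rightarrow> real \<Rightarrow> real) \<Rightarrow> real \<Rightarrow> nat \<Rightarrow> real \<Rightarrow> real" where
  "recovery_bd \<mu> \<sigma> g \<alpha> \<epsilon>1 \<epsilon>2 K A \<phi> e1 k b =
     1 / cmod (c_psi \<mu> \<sigma> g \<alpha> b) *
       (e1 * ln ((\<mu> * \<sigma> b + \<alpha>) / (\<mu> * \<sigma> b - \<alpha>))
        + 2 * \<alpha> / deriv (\<phi> k) b * err_bound \<mu> \<sigma> \<alpha> \<epsilon>1 \<epsilon>2 K A \<phi> g k b
        + (\<Sum>l\<in>{1..K} - {k}. A l b * cmod (cross_coeff \<mu> \<sigma> g \<alpha> \<phi> l k b)))"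

definition threshold_cond ::
  "real \<Rightarrow> (real \<Rightarrow> real) \<Rightarrow> (real \<Rightarrow> complex) \<Rightarrow> real \<Rightarrow> real \<Rightarrow> real \<Rightarrow> real \<Rightarrow>
   nat \<Rightarrow> (nat \<Rightarrow> real \<Rightarrow> real) \<Rightarrow> (nat \<Rightarrow> real \<Rightarrow> real) \<Rightarrow> real \<Rightarrow> real \<Rightarrow> bool" where
  "threshold_cond \<mu> \<sigma> g \<alpha> \<tau>0 \<epsilon>1 \<epsilon>2 K A \<phi> e1 b \<longleftrightarrow>
     e1 \<ge> scale_max \<mu> \<sigma> \<alpha> \<phi> b * \<sigma> b * err_bound \<mu> \<sigma> \<alpha> \<epsilon>1 \<epsilon>2 K A \<phi> g 1 b
          + \<tau>0 * (\<Sum>k=1..K. A k b)"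

end

(* Rescaling t = sigma(b) s gives W(a,b) = int x(b + a sigma(b) s) g(s) e^{-2 pi i mu sigma(b) s} ds.
   Differentiating under the integral in b and integrating by parts moves the derivative from x to g:
   all terms containing sigma' cancel against the corrections in the phase transformation, leaving
   omega^{adp,c} = mu/a - W^{g'}/(2 pi i a sigma W).  Since the Fourier transform of g' at eta is
   2 pi i eta times that of g, inserting the linearisations W = sum_k x_k(b) g^(eta_k) + rem_0 and the
   analogue for g' yields the identity of (b); second-order Taylor bounds for the phases control the
   remainders, and the lower bound on sigma makes the zones Z_k pairwise disjoint.
   For (c), Fubini and the approximate identity h(./lambda)/lambda turn the limit into the integral of
   W(a,b)/a over those a above the threshold with |omega - phi_k'| < e3, which by (a), (b) and the
   frequency gap are exactly the a in Z_k above the threshold; the integral over the whole of Z_k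
   evaluates to c_psi x_k(b) plus the cross terms and the remainder. *)
theory Submission
  imports Defs "HOL-Probability.Sinc_Integral"
begin

subsection \<open>Differentiation and integration on the real line\<close>

text \<open>What remains is that the difference quotients of \<sigma> at b itself are bounded near
  b; this dominates the difference quotients of the integral. The weight in the integration by parts
  is forced. The argument b + a \<sigma>(b) s moves at rate 1 + a \<sigma>'(b) s in b and at rate a
  \<sigma>(b) in s, so the quotient of the two rates trades one derivative for the other. Being
  affine in s, it creates the first moment of g', which is why the phase transformation carries a
  term with t g'(t). Part (c) depends on the strictness of (b): above the threshold, |\<omega> -
  \<phi>_k'| is below e3 on Z_k, above e3 on every other zone, and never equal to e3. At equality
  the window would cut the kernel at its centre, and the limit would be the integral of h over a
  half-line instead of 0 or 1.\<close>

lemma exp_eq_cis: "exp (\<i> * complex_of_real r) = cis r" "exp (- (\<i> * complex_of_real r)) = cis (- r)"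
  by (simp_all add: cis_conv_exp)

lemma has_vector_derivative_cis [derivative_intros]:
  assumes "(f has_real_derivative f') (at t within S)"
  shows "((\<lambda>t. cis (f t)) has_vector_derivative \<i> * of_real f' * cis (f t)) (at t within S)"
proof -
  have "((\<lambda>t. Complex (cos (f t)) (sin (f t))) has_vector_derivative Complex (- sin (f t) * f') (cos (f t) * f')) (at t within S)"
    unfolding has_vector_derivative_complex_iff by (auto intro!: derivative_eq_intros assms)
  then show ?thesis
    by (simp add: cis.code complex_eq_iff Complex_eq algebra_simps)
qed

lemma norm_diff_le_derivative_bound:
  fixes f :: "real \<Rightarrow> 'a::real_normed_vector"
  assumes "\<And>t. (f has_vector_derivative f' t) (at t)" and "\<And>t. norm (f' t) \<le> M"
  shows "norm (f u - f v) \<le> M * \<bar>u - v\<bar>"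
proof -
  have "norm (f u - f v) \<le> M * norm (u - v)"
  proof (rule differentiable_bound[where S = UNIV and f' = "\<lambda>t h. h *\<^sub>R f' t"])
    show "onorm (\<lambda>h. h *\<^sub>R f' t) \<le> M" for t
      using assms(2)[of t] by (intro onorm_le) (simp add: mult.commute[of M] mult_left_mono)
  qed (use assms(1) in \<open>auto simp: has_vector_derivative_def intro: has_derivative_at_withinI\<close>)
  then show ?thesis by simp
qed

lemma norm_cis_diff_le: "cmod (cis u - cis v) \<le> \<bar>u - v\<bar>"
proof -
  have "(cis has_vector_derivative \<i> * cis t) (at t)" for t
    using has_vector_derivative_cis[of "\<lambda>t. t" 1 t UNIV] by simp
  from norm_diff_le_derivative_bound[OF this, of 1 u v] show ?thesis
    by (simp add: norm_mult)
qed

lemma integral_derivative_UNIV_eq_0: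
  fixes F f :: "real \<Rightarrow> 'a::euclidean_space"
  assumes "\<And>t. (F has_vector_derivative f t) (at t)" and "continuous_on UNIV f"
    and "integrable lborel f" and "(F \<longlongrightarrow> 0) at_top" and "(F \<longlongrightarrow> 0) at_bot"
  shows "(LBINT t. f t) = 0"
proof -
  have "(LBINT t=-\<infinity>..\<infinity>. f t) = 0 - 0"
    using assms
    by (intro interval_integral_FTC_integrable[where F = F])
       (auto simp: ereal_tendsto_simps set_integrable_def continuous_on_eq_continuous_at)
  then show ?thesis
    by (simp add: interval_lebesgue_integral_def set_lebesgue_integral_def)
qed

lemma integrable_bounded_mult:
  fixes f w :: "real \<Rightarrow> complex"
  assumes "integrable lborel w" and "f \<in> borel_measurable borel" and "\<And>t. cmod (f t) \<le> M"
  shows "integrable lborel (\<lambda>t. f t * w t)"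
proof (rule Bochner_Integration.integrable_bound[where f = "\<lambda>t. M * cmod (w t)"])
  show "AE t in lborel. norm (f t * w t) \<le> norm (M * cmod (w t))"
  proof (intro AE_I2)
    fix t
    have "cmod (f t) * cmod (w t) \<le> \<bar>M\<bar> * cmod (w t)"
      using assms(3)[of t] by (intro mult_right_mono) auto
    then show "norm (f t * w t) \<le> norm (M * cmod (w t))"
      by (simp add: norm_mult abs_mult)
  qed
qed (use assms in auto)

text \<open>The boundary terms vanish because y is bounded and w tends to 0. In the form of a
  \<open>has_bochner_integral\<close> with value 0, the product derivative can be added to another
  integrand without changing its integral.\<close>

lemma integral_by_parts_UNIV:
  fixes y y' w w' :: "real \<Rightarrow> complex"
  assumes y: "\<And>t. (y has_vector_derivative y' t) (at t)" "\<And>t. cmod (y t) \<le> M"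
      "\<And>t. cmod (y' t) \<le> M'" "continuous_on UNIV y'"
    and w: "\<And>t. (w has_vector_derivative w' t) (at t)" "continuous_on UNIV w'"
      "integrable lborel w" "integrable lborel w'" "(w \<longlongrightarrow> 0) at_top" "(w \<longlongrightarrow> 0) at_bot"
  shows "has_bochner_integral lborel (\<lambda>t. y t * w' t + y' t * w t) 0"
proof -
  have cont: "continuous_on UNIV y" "continuous_on UNIV w"
    using y(1) w(1) by (auto simp: continuous_on_eq_continuous_at intro: has_vector_derivative_continuous)
  have int: "integrable lborel (\<lambda>t. y t * w' t + y' t * w t)"
    using y w cont
    by (intro Bochner_Integration.integrable_add integrable_bounded_mult)
       (auto intro!: borel_measurable_continuous_onI)
  moreover have "(LBINT t. y t * w' t + y' t * w t) = 0"
  proof (rule integral_derivative_UNIV_eq_0[where F = "\<lambda>t. y t * w t"])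
    show "((\<lambda>t. y t * w t) has_vector_derivative y t * w' t + y' t * w t) (at t)" for t
      by (intro has_vector_derivative_mult y w)
    show "continuous_on UNIV (\<lambda>t. y t * w' t + y' t * w t)"
      by (intro continuous_intros cont y w)
    have "((\<lambda>t. y t * w t) \<longlongrightarrow> 0) F" if "(w \<longlongrightarrow> 0) F" for F
    proof (rule tendsto_mult_right_zero[THEN Lim_null_comparison[rotated]])
      show "\<forall>\<^sub>F t in F. norm (y t * w t) \<le> M * cmod (w t)"
        using y(2) by (intro always_eventually allI) (simp add: norm_mult mult_right_mono)
      show "((\<lambda>t. cmod (w t)) \<longlongrightarrow> 0) F" using that by (rule tendsto_norm_zero)
    qed
    then show "((\<lambda>t. y t * w t) \<longlongrightarrow> 0) at_top" "((\<lambda>t. y t * w t) \<longlongrightarrow> 0) at_bot"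
      using w by auto
  qed (rule int)
  ultimately show ?thesis
    by (simp add: has_bochner_integral_iff)
qed

section \<open>Differentiation under the integral sign at a single parameter value\<close>

lemma has_vector_derivative_iff_quotient:
  "(f has_vector_derivative D) (at b) \<longleftrightarrow> ((\<lambda>y. (f y - f b) /\<^sub>R (y - b)) \<longlongrightarrow> D) (at b)"
proof -
  have "norm (f y - f b - (y - b) *\<^sub>R D) / norm (y - b) = norm ((f y - f b) /\<^sub>R (y - b) - D)"
    if "y \<noteq> b" for y
  proof -
    have "(f y - f b) /\<^sub>R (y - b) - D = (f y - f b - (y - b) *\<^sub>R D) /\<^sub>R (y - b)"
      using that by (simp add: scaleR_diff_right)
    then show ?thesis
      by (simp add: divide_inverse abs_inverse mult.commute)
  qed
  then have "((\<lambda>y. norm (f y - f b - (y - b) *\<^sub>R D) / norm (y - b)) \<longlongrightarrow> 0) (at b) \<longleftrightarrow>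
      ((\<lambda>y. norm ((f y - f b) /\<^sub>R (y - b) - D)) \<longlongrightarrow> 0) (at b)"
    by (intro filterlim_cong refl) (auto simp: eventually_at_filter)
  then show ?thesis
    by (simp add: has_vector_derivative_def has_derivative_iff_norm bounded_linear_scaleR_left
        tendsto_norm_zero_iff LIM_zero_iff)
qed

text \<open>Domination is asked of the increments from b, not of derivatives at neighbouring
  parameters: the difference quotients converge pointwise and are bounded by B, so dominated
  convergence applies to them directly. This is the form that suits an integrand depending on b
  through \<sigma>.\<close>

lemma has_vector_derivative_lebesgue_integral:
  fixes f :: "real \<Rightarrow> 'b \<Rightarrow> complex"
  assumes int: "\<And>y. integrable M (f y)"
    and deriv: "\<And>s. ((\<lambda>y. f y s) has_vector_derivative f' s) (at b)"
    and meas: "f' \<in> borel_measurable M"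
    and bound: "\<forall>\<^sub>F y in at b. \<forall>s. cmod (f y s - f b s) \<le> \<bar>y - b\<bar> * B s"
    and B: "integrable M B"
  shows "((\<lambda>y. \<integral>s. f y s \<partial>M) has_vector_derivative (\<integral>s. f' s \<partial>M)) (at b)"
proof -
  have lim: "((\<lambda>y. (f y s - f b s) /\<^sub>R (y - b)) \<longlongrightarrow> f' s) (at b)" for s
    using deriv[of s] by (simp add: has_vector_derivative_iff_quotient)
  have "((\<lambda>y. \<integral>s. (f y s - f b s) /\<^sub>R (y - b) \<partial>M) \<longlongrightarrow> (\<integral>s. f' s \<partial>M)) (at b)"
    unfolding tendsto_at_iff_sequentially comp_def
  proof (intro allI impI)
    fix X :: "nat \<Rightarrow> real" assume X: "\<forall>i. X i \<in> UNIV - {b}" "X \<longlonglongrightarrow> b"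
    then have "filterlim X (at b) sequentially"
      by (auto simp: filterlim_at)
    then have "\<forall>\<^sub>F i in sequentially. \<forall>s. cmod (f (X i) s - f b s) \<le> \<bar>X i - b\<bar> * B s"
      using bound unfolding filterlim_iff by blast
    then obtain N where N: "\<And>i s. i \<ge> N \<Longrightarrow> cmod (f (X i) s - f b s) \<le> \<bar>X i - b\<bar> * B s"
      by (auto simp: eventually_sequentially)
    show "(\<lambda>i. \<integral>s. (f (X i) s - f b s) /\<^sub>R (X i - b) \<partial>M) \<longlonglongrightarrow> (\<integral>s. f' s \<partial>M)"
    \<comment> \<open>The bound by B is known only from the index N on, so the sequence is shifted
      by N before dominated convergence is applied.\<close>
    proof (rule LIMSEQ_offset[where k = N], rule integral_dominated_convergence[where w = B])
      show "AE s in M. (\<lambda>i. (f (X (i + N)) s - f b s) /\<^sub>R (X (i + N) - b)) \<longlonglongrightarrow> f' s"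
        using lim X
        by (intro AE_I2 LIMSEQ_ignore_initial_segment) (auto simp: tendsto_at_iff_sequentially comp_def)
      show "AE s in M. cmod ((f (X (i + N)) s - f b s) /\<^sub>R (X (i + N) - b)) \<le> B s" for i
        using N[of "i + N"] X(1)
        by (intro AE_I2) (auto simp: abs_inverse divide_simps mult.commute)
    qed (use int B meas in auto)
  qed
  then show ?thesis
    by (simp add: has_vector_derivative_iff_quotient int Bochner_Integration.integral_diff)
qed

subsection \<open>Schwartz functions and the Fourier transform\<close>

lemma schwartz_vderiv: "schwartz g \<Longrightarrow> schwartz (vderiv g)"
  unfolding schwartz_def by (simp flip: funpow_swap1) (metis funpow.simps(2) comp_apply)

lemma schwartz_has_vector_derivative:
  "schwartz g \<Longrightarrow> (g has_vector_derivative vderiv g t) (at t)"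
  unfolding schwartz_def vderiv_def
  by (metis funpow_0 vector_derivative_works)

lemma schwartz_continuous: "schwartz g \<Longrightarrow> continuous_on UNIV g"
  by (auto simp: continuous_on_eq_continuous_at
      intro: has_vector_derivative_continuous schwartz_has_vector_derivative)

lemma schwartz_moment_bounded:
  assumes "schwartz g"
  obtains C where "\<And>t. \<bar>t\<bar> ^ n * cmod (g t) \<le> C"
proof -
  have "bounded (range (\<lambda>t. t ^ n *\<^sub>R (vderiv ^^ 0) g t))"
    using assms unfolding schwartz_def by blast
  then show ?thesis
    using that by (auto simp: bounded_iff power_abs)
qed

text \<open>Adding the bounds for the moments n and n + 2 bounds |t|^n |g(t)| (1 + t^2), which
  yields the integrable majorant (C + D) / (1 + t^2).\<close>

lemma schwartz_moment_integrable:
  assumes "schwartz g"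
  shows "integrable lborel (\<lambda>t. of_real (t ^ n) * g t)"
proof -
  obtain C D where C: "\<And>t. \<bar>t\<bar> ^ n * cmod (g t) \<le> C" and D: "\<And>t. \<bar>t\<bar> ^ (n + 2) * cmod (g t) \<le> D"
    using schwartz_moment_bounded[OF assms] by metis
  have "integrable lborel (\<lambda>t::real. inverse (1 + t\<^sup>2))"
    using integrable_inverse_1_plus_square by (simp add: set_integrable_def)
  then have "integrable lborel (\<lambda>t::real. (C + D) * inverse (1 + t\<^sup>2))"
    by simp
  then show ?thesis
  proof (rule Bochner_Integration.integrable_bound)
    show "(\<lambda>t. complex_of_real (t ^ n) * g t) \<in> borel_measurable lborel"
      using schwartz_continuous[OF assms]
      by (auto intro!: borel_measurable_continuous_onI continuous_intros)
    show "AE t in lborel. norm (complex_of_real (t ^ n) * g t) \<le> norm ((C + D) * inverse (1 + t\<^sup>2))"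
    proof (intro AE_I2)
      fix t :: real
      have p: "1 + t\<^sup>2 > 0" by (simp add: add_pos_nonneg)
      have "\<bar>t\<bar> ^ n * cmod (g t) * (1 + t\<^sup>2) \<le> C + D"
        using C[of t] D[of t] by (simp add: algebra_simps power_add power2_eq_square)
      then have "\<bar>t\<bar> ^ n * cmod (g t) \<le> (C + D) * inverse (1 + t\<^sup>2)"
        using p by (simp add: field_simps)
      then show "norm (complex_of_real (t ^ n) * g t) \<le> norm ((C + D) * inverse (1 + t\<^sup>2))"
        by (simp add: norm_mult norm_power)
    qed
  qed
qed

lemma schwartz_integrable: "schwartz g \<Longrightarrow> integrable lborel g"
  using schwartz_moment_integrable[of g 0] by simp

lemma schwartz_moment_tendsto_0:
  assumes "schwartz g"
  shows "((\<lambda>t. of_real (t ^ n) * g t) \<longlongrightarrow> 0) at_infinity"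
proof -
  obtain C where C: "\<And>t. \<bar>t\<bar> ^ (n + 1) * cmod (g t) \<le> C"
    using schwartz_moment_bounded[OF assms] by metis
  show ?thesis
  proof (rule Lim_null_comparison)
    show "\<forall>\<^sub>F t in at_infinity. norm (complex_of_real (t ^ n) * g t) \<le> C * inverse \<bar>t\<bar>"
      unfolding eventually_at_infinity
    proof (intro exI allI impI)
      fix t :: real assume "1 \<le> norm t"
      then show "norm (complex_of_real (t ^ n) * g t) \<le> C * inverse \<bar>t\<bar>"
        using C[of t] by (simp add: norm_mult norm_power field_simps)
    qed
    have "((\<lambda>t::real. inverse t) \<longlongrightarrow> 0) at_infinity"
      by (rule tendsto_inverse_0)
    then have "((\<lambda>t::real. inverse \<bar>t\<bar>) \<longlongrightarrow> 0) at_infinity"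
      using tendsto_rabs_zero_iff[of "\<lambda>t::real. inverse t" at_infinity] by (simp add: abs_inverse)
    then show "((\<lambda>t::real. C * inverse \<bar>t\<bar>) \<longlongrightarrow> 0) at_infinity"
      by (rule tendsto_mult_right_zero)
  qed
qed

lemma schwartz_moment_tendsto_0_at_top_bot:
  assumes "schwartz g"
  shows "((\<lambda>t. of_real (t ^ n) * g t) \<longlongrightarrow> 0) at_top" "((\<lambda>t. of_real (t ^ n) * g t) \<longlongrightarrow> 0) at_bot"
  using schwartz_moment_tendsto_0[OF assms] filterlim_mono[OF _ order_refl]
    at_top_le_at_infinity at_bot_le_at_infinity by blast+

lemma fourier_eq: "fourier f \<xi> = (LBINT t. cis (- (2 * pi * \<xi> * t)) * f t)"
  unfolding fourier_def exp_eq_cis by (simp only: mult.commute)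

lemma cis_linear_has_vector_derivative:
  "((\<lambda>t. cis (c * t)) has_vector_derivative \<i> * of_real c * cis (c * t)) (at t)"
  by (auto intro!: has_vector_derivative_cis derivative_eq_intros)

lemma fourier_vderiv:
  assumes "schwartz g"
  shows "fourier (vderiv g) \<xi> = \<i> * of_real (2 * pi * \<xi>) * fourier g \<xi>"
proof -
  note g = schwartz_has_vector_derivative[OF assms] schwartz_integrable[OF assms]
    schwartz_integrable[OF schwartz_vderiv[OF assms]] schwartz_continuous[OF schwartz_vderiv[OF assms]]
    schwartz_moment_tendsto_0_at_top_bot[OF assms, of 0, simplified]
  let ?E = "\<lambda>t. cis (- (2 * pi * \<xi>) * t)"
  let ?E' = "\<lambda>t. \<i> * of_real (- (2 * pi * \<xi>)) * ?E t"
  have meas: "?E \<in> borel_measurable borel"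
    by (intro borel_measurable_continuous_onI continuous_intros)
  have "has_bochner_integral lborel (\<lambda>t. ?E t * vderiv g t + ?E' t * g t) 0"
    by (rule integral_by_parts_UNIV[where M = 1 and M' = "\<bar>2 * pi * \<xi>\<bar>",
          OF cis_linear_has_vector_derivative])
       (use g in \<open>auto intro!: continuous_intros simp: norm_mult abs_mult\<close>)
  moreover have int: "integrable lborel (\<lambda>t. ?E t * vderiv g t)" "integrable lborel (\<lambda>t. ?E t * g t)"
    using g meas by (auto intro!: integrable_bounded_mult[where M = 1])
  ultimately have "(LBINT t. ?E t * vderiv g t) + (\<i> * of_real (- (2 * pi * \<xi>))) * (LBINT t. ?E t * g t) = 0"
    by (auto simp: mult.assoc has_bochner_integral_iff Bochner_Integration.integral_add)
  then show ?thesis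
    by (simp add: fourier_eq algebra_simps)
qed

subsection \<open>The adaptive wavelet transform of a bounded signal\<close>

text \<open>After the substitution the window is evaluated at a point free of b, so a derivative in
  b falls only on the signal and the exponential, and g needs no differentiation at that
  stage.\<close>

lemma acwt_rescale:
  assumes "\<sigma> b > 0"
  shows "acwt \<mu> \<sigma> w x a b
    = (LBINT s. x (b + a * \<sigma> b * s) * cis (- (2 * pi * \<mu> * \<sigma> b) * s) * w s)"
proof -
  let ?F = "\<lambda>t. x (b + a * t) * complex_of_real (1 / \<sigma> b) * w (t / \<sigma> b) * cis (- (2 * pi * \<mu> * t))"
  have "acwt \<mu> \<sigma> w x a b = (LBINT t. ?F t)"
    unfolding acwt_def exp_eq_cis by (simp add: mult.assoc)
  also have "\<dots> = (LBINT s. \<sigma> b *\<^sub>R ?F (0 + \<sigma> b * s))"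
    using assms by (subst lborel_integral_real_affine[where c = "\<sigma> b" and t = 0]) simp_all
  also have "\<dots> = (LBINT s. x (b + a * \<sigma> b * s) * cis (- (2 * pi * \<mu> * \<sigma> b) * s) * w s)"
    using assms by (intro Bochner_Integration.integral_cong refl) (simp add: scaleR_conv_of_real mult_ac)
  finally show ?thesis .
qed

lemma acwt_integrand_integrable:
  assumes "continuous_on UNIV x" and "\<And>t. cmod (x t) \<le> M" and "integrable lborel w"
  shows "integrable lborel (\<lambda>s. x (b + c * s) * cis (d * s) * w s)"
proof (rule integrable_bounded_mult[where M = M])
  show "(\<lambda>s. x (b + c * s) * cis (d * s)) \<in> borel_measurable borel"
    by (intro borel_measurable_continuous_onI continuous_intros
        continuous_on_compose2[OF assms(1)]) auto
qed (use assms in \<open>auto simp: norm_mult\<close>)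

text \<open>Continuity in the scale provides measurability in a, boundedness on the compact range of
  scales and integrability over a zone, all of which the reassignment integral relies on.\<close>

lemma acwt_continuous_scale:
  assumes "continuous_on UNIV x" and "\<And>t. cmod (x t) \<le> M" and "integrable lborel w" and "\<sigma> b > 0"
  shows "continuous_on UNIV (\<lambda>a. acwt \<mu> \<sigma> w x a b)"
proof (rule continuous_on_sequentiallyI)
  fix u :: "nat \<Rightarrow> real" and a assume u: "u \<longlonglongrightarrow> a"
  have int: "integrable lborel (\<lambda>s. x (b + c * s) * cis (d * s) * w s)" for c d
    by (rule acwt_integrand_integrable[OF assms(1-3)])
  show "(\<lambda>n. acwt \<mu> \<sigma> w x (u n) b) \<longlonglongrightarrow> acwt \<mu> \<sigma> w x a b"
    unfolding acwt_rescale[of \<sigma>, OF assms(4)]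
  proof (rule integral_dominated_convergence[where w = "\<lambda>s. M * cmod (w s)"])
    show "AE s in lborel. (\<lambda>n. x (b + u n * \<sigma> b * s) * cis (- (2 * pi * \<mu> * \<sigma> b) * s) * w s)
        \<longlonglongrightarrow> x (b + a * \<sigma> b * s) * cis (- (2 * pi * \<mu> * \<sigma> b) * s) * w s"
    proof (intro AE_I2 tendsto_mult tendsto_const)
      fix s
      have "isCont x (b + a * \<sigma> b * s)"
        using assms(1) by (simp add: continuous_on_eq_continuous_at)
      then show "(\<lambda>n. x (b + u n * \<sigma> b * s)) \<longlonglongrightarrow> x (b + a * \<sigma> b * s)"
        by (rule isCont_tendsto_compose) (intro tendsto_intros u)
    qed
    show "AE s in lborel. norm (x (b + u n * \<sigma> b * s) * cis (- (2 * pi * \<mu> * \<sigma> b) * s) * w s)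
        \<le> M * cmod (w s)" for n
      using assms(2) by (intro AE_I2) (auto simp: norm_mult intro: mult_right_mono)
    show "(\<lambda>s. x (b + u n * \<sigma> b * s) * cis (- (2 * pi * \<mu> * \<sigma> b) * s) * w s) \<in> borel_measurable lborel" for n
      by (rule borel_measurable_integrable[OF int])
    show "(\<lambda>s. x (b + a * \<sigma> b * s) * cis (- (2 * pi * \<mu> * \<sigma> b) * s) * w s) \<in> borel_measurable lborel"
      by (rule borel_measurable_integrable[OF int])
  qed (use assms(3) in auto)
qed

text \<open>Here K stands for 2 pi \<mu>, S and S' for \<sigma> and \<sigma>' at b, X and Y for the
  signal and its derivative at b + a S t, and e for the exponential. The left side is the
  b-derivative of the rescaled integrand. The first bracket on the right is the t-derivative of the
  product of X e and (1 + a S' t) / (a S) G; it integrates to 0 and takes every occurrence of Y with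
  it.\<close>

lemma acwt_derivative_algebra:
  fixes a S S' t K X Y e G G' :: complex
  assumes "a \<noteq> 0" "S \<noteq> 0"
  shows "(X * (\<i> * (- (K * S') * t) * e) + (1 + a * S' * t) * Y * e) * G =
    (X * e * ((1 + a * S' * t) / (a * S) * G' + a * S' / (a * S) * G)
      + (X * (\<i> * (- (K * S)) * e) + a * S * Y * e) * ((1 + a * S' * t) / (a * S) * G))
    + (\<i> * (K / a) * (X * e * G) - X * e * G' / (a * S)
      - S' / S * (X * e * G + X * e * (t * G')))"
  using assms by (simp add: divide_simps) (simp add: algebra_simps)

lemma acwt_has_vector_derivative:
  assumes x: "\<And>t. (x has_vector_derivative x' t) (at t)" "\<And>t. cmod (x t) \<le> M"
      "\<And>t. cmod (x' t) \<le> M'" "continuous_on UNIV x'"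
    and g: "schwartz g" and \<sigma>: "\<And>t. \<sigma> t > 0" "(\<sigma> has_real_derivative s') (at b)" and a: "a > 0"
  shows "((\<lambda>b'. acwt \<mu> \<sigma> g x a b') has_vector_derivative
    (\<i> * of_real (2 * pi * \<mu> / a) * acwt \<mu> \<sigma> g x a b
      - acwt \<mu> \<sigma> (vderiv g) x a b / of_real (a * \<sigma> b)
      - of_real (s' / \<sigma> b) *
        (acwt \<mu> \<sigma> g x a b + acwt \<mu> \<sigma> (\<lambda>t. of_real t * vderiv g t) x a b))) (at b)"
proof -
  define \<kappa> c where "\<kappa> = 2 * pi * \<mu>" and "c = a * \<sigma> b"
  have c: "c > 0" using a \<sigma>(1) by (simp add: c_def)
  have M: "M \<ge> 0" "M' \<ge> 0" using x(2,3)[of 0] norm_ge_zero order_trans by blast+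
  define E where "E = (\<lambda>s. cis (- (\<kappa> * \<sigma> b) * s))"
  define f where "f = (\<lambda>y s. x (y + a * \<sigma> y * s) * cis (- (\<kappa> * \<sigma> y) * s) * g s)"
  define f' where "f' = (\<lambda>s. (x (b + c * s) * (\<i> * of_real (- (\<kappa> * s') * s) * E s)
      + ((1 + a * s' * s) *\<^sub>R x' (b + c * s)) * E s) * g s)"
  have cont_x: "continuous_on UNIV x"
    using x(1) by (auto simp: continuous_on_eq_continuous_at intro: has_vector_derivative_continuous)
  note cont_shift = continuous_on_compose2[OF cont_x] continuous_on_compose2[OF x(4)]
  have moments: "integrable lborel g" "integrable lborel (vderiv g)"
      "integrable lborel (\<lambda>t. of_real t * g t)" "integrable lborel (\<lambda>t. of_real t * vderiv g t)"
    using schwartz_moment_integrable[OF g, of 1] schwartz_moment_integrable[OF schwartz_vderiv[OF g], of 1]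
      schwartz_integrable[OF g] schwartz_integrable[OF schwartz_vderiv[OF g]] by auto
  have acwt_eq: "acwt \<mu> \<sigma> w x a y = (LBINT s. x (y + a * \<sigma> y * s) * cis (- (\<kappa> * \<sigma> y) * s) * w s)" for w y
    using acwt_rescale[of \<sigma> y \<mu> w x a] \<sigma>(1) by (simp add: \<kappa>_def)
  have "((\<lambda>y. LBINT s. f y s) has_vector_derivative (LBINT s. f' s)) (at b)"
  proof (rule has_vector_derivative_lebesgue_integral)
    show "integrable lborel (f y)" for y
      unfolding f_def by (rule acwt_integrand_integrable[OF cont_x x(2) moments(1)])
    show "((\<lambda>y. f y s) has_vector_derivative f' s) (at b)" for s
    proof -
      have "((\<lambda>y. y + a * \<sigma> y * s) has_vector_derivative 1 + a * s' * s) (at b)"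
        by (auto intro!: derivative_eq_intros \<sigma> simp flip: has_real_derivative_iff_has_vector_derivative)
      from vector_diff_chain_at[OF this x(1)]
      have "((\<lambda>y. x (y + a * \<sigma> y * s)) has_vector_derivative (1 + a * s' * s) *\<^sub>R x' (b + c * s)) (at b)"
        by (simp add: comp_def c_def)
      moreover have "((\<lambda>y. cis (- (\<kappa> * \<sigma> y) * s)) has_vector_derivative
          \<i> * of_real (- (\<kappa> * s') * s) * cis (- (\<kappa> * \<sigma> b) * s)) (at b)"
        by (rule has_vector_derivative_cis) (auto intro!: derivative_eq_intros \<sigma>)
      ultimately have "((\<lambda>y. x (y + a * \<sigma> y * s) * cis (- (\<kappa> * \<sigma> y) * s)) has_vector_derivative
         (x (b + a * \<sigma> b * s) * (\<i> * of_real (- (\<kappa> * s') * s) * cis (- (\<kappa> * \<sigma> b) * s))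
          + ((1 + a * s' * s) *\<^sub>R x' (b + c * s)) * cis (- (\<kappa> * \<sigma> b) * s))) (at b)"
        by (rule has_vector_derivative_mult)
      from has_vector_derivative_mult[OF this has_vector_derivative_const[of "g s"]]
      show ?thesis
        unfolding f_def f'_def E_def c_def by simp
    qed
    show "f' \<in> borel_measurable lborel"
      unfolding f'_def E_def using schwartz_continuous[OF g]
      by (auto intro!: borel_measurable_continuous_onI continuous_intros cont_shift)
    \<comment> \<open>D bounds the difference quotients of \<sigma> at b near b, since these
      converge to s'. In B, the M' part controls the increment of x, whose argument moves by at most
      |y - b| (1 + a D |s|), and the M part controls the increment of the exponential; the factors
      |s| are paid for by the first moment of g.\<close>
    define D where "D = \<bar>s'\<bar> + 1"
    have D: "D > 0" by (simp add: D_def)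
    define B where "B = (\<lambda>s. (M' * (1 + a * D * \<bar>s\<bar>) + M * (\<bar>\<kappa>\<bar> * D * \<bar>s\<bar>)) * cmod (g s))"
    have "integrable lborel (\<lambda>s. M' * cmod (g s) + (M' * a * D + M * \<bar>\<kappa>\<bar> * D) * cmod (of_real s * g s))"
      using moments by auto
    then show "integrable lborel B"
      by (simp add: B_def algebra_simps norm_mult)
    have "((\<lambda>y. (\<sigma> y - \<sigma> b) / (y - b)) \<longlongrightarrow> s') (at b)"
      using \<sigma>(2) by (simp add: has_field_derivative_iff)
    then have "((\<lambda>y. \<bar>(\<sigma> y - \<sigma> b) / (y - b)\<bar>) \<longlongrightarrow> \<bar>s'\<bar>) (at b)"
      by (rule tendsto_rabs)
    then have "\<forall>\<^sub>F y in at b. \<bar>(\<sigma> y - \<sigma> b) / (y - b)\<bar> < D"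
      by (rule order_tendstoD) (simp add: D_def)
    moreover have "\<forall>\<^sub>F y in at b. y \<noteq> b"
      by (simp add: eventually_at_filter)
    ultimately show "\<forall>\<^sub>F y in at b. \<forall>s. cmod (f y s - f b s) \<le> \<bar>y - b\<bar> * B s"
    proof eventually_elim
      case (elim y)
      then have \<sigma>_lip: "\<bar>\<sigma> y - \<sigma> b\<bar> \<le> D * \<bar>y - b\<bar>"
        by (simp add: abs_divide field_simps)
      show ?case
      proof
        fix s
        let ?u = "y + a * \<sigma> y * s" and ?v = "b + a * \<sigma> b * s"
        let ?p = "cis (- (\<kappa> * \<sigma> y) * s)" and ?q = "cis (- (\<kappa> * \<sigma> b) * s)"
        have s\<sigma>: "\<bar>s\<bar> * \<bar>\<sigma> y - \<sigma> b\<bar> \<le> \<bar>s\<bar> * (D * \<bar>y - b\<bar>)"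
          using \<sigma>_lip by (rule mult_left_mono) simp
        have "cmod (x ?u - x ?v) \<le> M' * \<bar>?u - ?v\<bar>"
          by (rule norm_diff_le_derivative_bound[OF x(1,3)])
        also have "?u - ?v = (y - b) + a * (s * (\<sigma> y - \<sigma> b))" by (simp add: algebra_simps)
        also have "\<bar>(y - b) + a * (s * (\<sigma> y - \<sigma> b))\<bar> \<le> \<bar>y - b\<bar> + a * (\<bar>s\<bar> * \<bar>\<sigma> y - \<sigma> b\<bar>)"
          using a by (simp add: abs_mult order_trans[OF abs_triangle_ineq])
        also have "\<dots> \<le> \<bar>y - b\<bar> + a * (\<bar>s\<bar> * (D * \<bar>y - b\<bar>))"
          using s\<sigma> a by simp
        finally have 1: "cmod (x ?u - x ?v) \<le> M' * (\<bar>y - b\<bar> + a * (\<bar>s\<bar> * (D * \<bar>y - b\<bar>)))"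
          using M by (simp add: mult_left_mono)
        have "cmod (?p - ?q) \<le> \<bar>- (\<kappa> * \<sigma> y) * s - - (\<kappa> * \<sigma> b) * s\<bar>"
          by (rule norm_cis_diff_le)
        also have "- (\<kappa> * \<sigma> y) * s - - (\<kappa> * \<sigma> b) * s = - (\<kappa> * (s * (\<sigma> y - \<sigma> b)))"
          by (simp add: algebra_simps)
        also have "\<bar>- (\<kappa> * (s * (\<sigma> y - \<sigma> b)))\<bar> = \<bar>\<kappa>\<bar> * (\<bar>s\<bar> * \<bar>\<sigma> y - \<sigma> b\<bar>)"
          by (simp add: abs_mult)
        also have "\<dots> \<le> \<bar>\<kappa>\<bar> * (\<bar>s\<bar> * (D * \<bar>y - b\<bar>))"
          by (intro mult_left_mono s\<sigma>) simp
        finally have 2: "cmod (?p - ?q) \<le> \<bar>\<kappa>\<bar> * (\<bar>s\<bar> * (D * \<bar>y - b\<bar>))" .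
        have "f y s - f b s = ((x ?u - x ?v) * ?p + x ?v * (?p - ?q)) * g s"
          by (simp add: f_def algebra_simps)
        also have "cmod \<dots> \<le> (cmod (x ?u - x ?v) + cmod (x ?v) * cmod (?p - ?q)) * cmod (g s)"
          by (simp add: norm_mult mult_right_mono norm_triangle_le)
        also have "\<dots> \<le> (M' * (\<bar>y - b\<bar> + a * (\<bar>s\<bar> * (D * \<bar>y - b\<bar>))) + M * (\<bar>\<kappa>\<bar> * (\<bar>s\<bar> * (D * \<bar>y - b\<bar>)))) * cmod (g s)"
          using M by (intro mult_right_mono add_mono mult_mono 1 2 x) auto
        also have "\<dots> = \<bar>y - b\<bar> * B s"
          by (simp add: B_def algebra_simps)
        finally show "cmod (f y s - f b s) \<le> \<bar>y - b\<bar> * B s" .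
      qed
    qed
  qed
  moreover have "(LBINT s. f' s) = \<i> * of_real (2 * pi * \<mu> / a) * acwt \<mu> \<sigma> g x a b
      - acwt \<mu> \<sigma> (vderiv g) x a b / of_real (a * \<sigma> b)
      - of_real (s' / \<sigma> b) *
        (acwt \<mu> \<sigma> g x a b + acwt \<mu> \<sigma> (\<lambda>t. of_real t * vderiv g t) x a b)"
  proof -
    define y where "y = (\<lambda>s. x (b + c * s) * E s)"
    define y' where "y' = (\<lambda>s. x (b + c * s) * (\<i> * of_real (- (\<kappa> * \<sigma> b)) * E s)
        + (c *\<^sub>R x' (b + c * s)) * E s)"
    define w where "w = (\<lambda>s. of_real ((1 + a * s' * s) / c) * g s)"
    define w' where "w' = (\<lambda>s. of_real ((1 + a * s' * s) / c) * vderiv g s + of_real (a * s' / c) * g s)"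
    have parts: "has_bochner_integral lborel (\<lambda>s. y s * w' s + y' s * w s) 0"
    proof (rule integral_by_parts_UNIV)
      show "(y has_vector_derivative y' s) (at s)" for s
      proof -
        have "((\<lambda>s. b + c * s) has_vector_derivative c) (at s)"
          by (auto intro!: derivative_eq_intros simp flip: has_real_derivative_iff_has_vector_derivative)
        from vector_diff_chain_at[OF this x(1)]
        have "((\<lambda>s. x (b + c * s)) has_vector_derivative c *\<^sub>R x' (b + c * s)) (at s)"
          by (simp add: comp_def)
        from has_vector_derivative_mult[OF this cis_linear_has_vector_derivative]
        show ?thesis unfolding y_def y'_def E_def .
      qed
      show "cmod (y s) \<le> M" for s
        using x(2) by (simp add: y_def E_def norm_mult)
      show "cmod (y' s) \<le> M * \<bar>\<kappa> * \<sigma> b\<bar> + c * M'" for s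
        unfolding y'_def E_def using x(2,3) c
        by (intro order_trans[OF norm_triangle_ineq] add_mono)
           (auto simp: norm_mult abs_mult intro!: mult_right_mono mult_left_mono)
      show "continuous_on UNIV y'"
        unfolding y'_def E_def by (intro continuous_intros cont_shift) auto
      show "(w has_vector_derivative w' s) (at s)" for s
      proof -
        have "((\<lambda>s. complex_of_real ((1 + a * s' * s) / c)) has_vector_derivative of_real (a * s' / c)) (at s)"
          using c by (intro has_vector_derivative_of_real)
             (auto intro!: derivative_eq_intros simp flip: has_real_derivative_iff_has_vector_derivative)
        from has_vector_derivative_mult[OF this schwartz_has_vector_derivative[OF g]]
        show ?thesis unfolding w_def w'_def .
      qed
      show "continuous_on UNIV w'"
        unfolding w'_def using c schwartz_continuous[OF g] schwartz_continuous[OF schwartz_vderiv[OF g]]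
        by (intro continuous_intros) auto
      \<comment> \<open>Expanding the affine weight presents w and w' as combinations of g, s g, g'
        and s g', whose integrability and, for w, decay are already known.\<close>
      define k l where "k = complex_of_real (1 / c)" and "l = complex_of_real (a * s' / c)"
      have "w = (\<lambda>s. k * g s + l * (of_real s * g s))"
        by (auto simp: w_def k_def l_def fun_eq_iff add_divide_distrib algebra_simps)
      moreover have "w' = (\<lambda>s. k * vderiv g s + l * (of_real s * vderiv g s) + l * g s)"
        by (auto simp: w'_def k_def l_def fun_eq_iff add_divide_distrib algebra_simps)
      ultimately show "integrable lborel w" "integrable lborel w'"
          "(w \<longlongrightarrow> 0) at_top" "(w \<longlongrightarrow> 0) at_bot"
        using moments schwartz_moment_tendsto_0_at_top_bot[OF g, of 0]
          schwartz_moment_tendsto_0_at_top_bot[OF g, of 1]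
        by (auto intro!: tendsto_add_zero tendsto_mult_right_zero)
    qed
    define u where "u = (\<lambda>v s. y s * v s)"
    have int: "integrable lborel (u g)" "integrable lborel (u (vderiv g))"
        "integrable lborel (u (\<lambda>t. of_real t * vderiv g t))"
      unfolding u_def y_def E_def
      by (intro acwt_integrand_integrable[OF cont_x x(2)] moments)+
    have eq: "f' s = (y s * w' s + y' s * w s) + (\<i> * of_real (2 * pi * \<mu> / a) * u g s
      - u (vderiv g) s / of_real (a * \<sigma> b) - of_real (s' / \<sigma> b) *
        (u g s + u (\<lambda>t. of_real t * vderiv g t) s))" for s
      using acwt_derivative_algebra[of "of_real a" "of_real (\<sigma> b)" "x (b + c * s)" "of_real \<kappa>" "of_real s'"
          "of_real s" "E s" "x' (b + c * s)" "g s" "vderiv g s"] a \<sigma>(1)[of b]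
      by (simp add: f'_def y_def y'_def w_def w'_def u_def \<kappa>_def c_def scaleR_conv_of_real)
    have "has_bochner_integral lborel f' (0 + (\<i> * of_real (2 * pi * \<mu> / a) * (LBINT s. u g s)
      - (LBINT s. u (vderiv g) s) / of_real (a * \<sigma> b) - of_real (s' / \<sigma> b) *
        ((LBINT s. u g s) + (LBINT s. u (\<lambda>t. of_real t * vderiv g t) s))))"
      unfolding eq[abs_def] using int
      by (intro has_bochner_integral_add has_bochner_integral_diff parts has_bochner_integral_mult_right
          has_bochner_integral_divide) (auto intro: has_bochner_integral_integrable)
    then show ?thesis
      by (simp add: has_bochner_integral_iff acwt_eq u_def y_def E_def c_def)
  qed
  ultimately show ?thesis
    unfolding f_def acwt_eq[symmetric] by simp
qed

section \<open>Spectral bounds for the window and two elementary estimates\<close>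

lemma fourier_continuous:
  assumes "integrable lborel w"
  shows "continuous_on UNIV (fourier w)"
proof (rule continuous_on_sequentiallyI)
  fix u :: "nat \<Rightarrow> real" and \<xi> assume u: "u \<longlonglongrightarrow> \<xi>"
  have int: "integrable lborel (\<lambda>t. cis (- (2 * pi * \<eta> * t)) * w t)" for \<eta>
    using assms by (intro integrable_bounded_mult[where M = 1] borel_measurable_continuous_onI continuous_intros) auto
  show "(\<lambda>n. fourier w (u n)) \<longlonglongrightarrow> fourier w \<xi>"
    unfolding fourier_eq
  proof (rule integral_dominated_convergence[where w = "\<lambda>t. cmod (w t)"])
    show "AE t in lborel. (\<lambda>n. cis (- (2 * pi * u n * t)) * w t) \<longlonglongrightarrow> cis (- (2 * pi * \<xi> * t)) * w t"
      by (intro AE_I2 tendsto_intros u)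
  qed (use borel_measurable_integrable[OF int] assms in \<open>auto simp: norm_mult\<close>)
qed

text \<open>The first bound serves the threshold in (a), the second replaces a scale-dependent
  argument by \<rho> in (b). For an even decreasing spectrum both are monotonicity applied to
  |\<xi>|; for a band-limited window the left sides vanish.\<close>

lemma essential_bandwidth_fourier_le:
  assumes "schwartz g" and "essential_bandwidth g \<alpha> \<tau>0" and "\<bar>\<xi>\<bar> \<ge> \<alpha>"
  shows "cmod (fourier g \<xi>) \<le> \<tau>0"
    and "\<lbrakk>\<alpha> \<le> \<rho>; \<rho> \<le> \<bar>\<xi>\<bar>\<rbrakk> \<Longrightarrow> cmod (fourier g \<xi>) \<le> cmod (fourier g \<rho>)"
proof -
  have \<alpha>: "\<alpha> > 0" using assms(2) by (simp add: essential_bandwidth_def)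
  consider
    (decreasing) "\<And>\<eta>. cmod (fourier g (- \<eta>)) = cmod (fourier g \<eta>)" "antimono_on {0..} (\<lambda>\<xi>. cmod (fourier g \<xi>))"
      "cmod (fourier g \<alpha>) = \<tau>0"
    | (bandlimited) "closure {\<xi>. fourier g \<xi> \<noteq> 0} \<subseteq> {-\<alpha>..\<alpha>}" "\<tau>0 = 0"
    using assms(2) unfolding essential_bandwidth_def by blast
  then have "cmod (fourier g \<xi>) \<le> \<tau>0 \<and>
    (\<alpha> \<le> \<rho> \<longrightarrow> \<rho> \<le> \<bar>\<xi>\<bar> \<longrightarrow> cmod (fourier g \<xi>) \<le> cmod (fourier g \<rho>))"
  proof cases
    case decreasing
    have "cmod (fourier g \<xi>) = cmod (fourier g \<bar>\<xi>\<bar>)"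
      using decreasing(1)[of \<xi>] by (auto simp: abs_if)
    moreover have "cmod (fourier g \<bar>\<xi>\<bar>) \<le> cmod (fourier g \<eta>)" if "\<alpha> \<le> \<eta>" "\<eta> \<le> \<bar>\<xi>\<bar>" for \<eta>
      using decreasing(2) that \<alpha> by (auto simp: monotone_on_def)
    ultimately show ?thesis using decreasing(3) assms(3) by force
  next
    case bandlimited
    have outside: "fourier g \<eta> = 0" if "\<bar>\<eta>\<bar> > \<alpha>" for \<eta>
      using that bandlimited(1) closure_subset[of "{\<xi>. fourier g \<xi> \<noteq> 0}"] by fastforce
    \<comment> \<open>The support condition alone forces a zero only where |\<xi>| > \<alpha>. The
      edge |\<xi>| = \<alpha> is reached by continuity, approaching it from outside along the
      direction sgn \<xi>.\<close>
    have "\<xi> \<in> closure {\<eta>. \<bar>\<eta>\<bar> > \<alpha>}"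
    proof (cases "\<bar>\<xi>\<bar> > \<alpha>")
      case False
      then have abs: "\<bar>\<xi>\<bar> = \<alpha>" using assms(3) by simp
      show ?thesis
        unfolding closure_approachable
      proof (intro allI impI)
        fix e :: real assume "e > 0"
        then have "dist (\<xi> + sgn \<xi> * (e / 2)) \<xi> < e \<and> \<bar>\<xi> + sgn \<xi> * (e / 2)\<bar> > \<alpha>"
          using abs \<alpha> by (auto simp: dist_real_def sgn_real_def abs_if split: if_splits)
        then show "\<exists>y\<in>{\<eta>. \<bar>\<eta>\<bar> > \<alpha>}. dist y \<xi> < e" by blast
      qed
    qed (use closure_subset[of "{\<eta>. \<bar>\<eta>\<bar> > \<alpha>}"] in auto)
    moreover have "continuous_on (closure {\<eta>. \<bar>\<eta>\<bar> > \<alpha>}) (fourier g)"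
      by (rule continuous_on_subset[OF fourier_continuous[OF schwartz_integrable[OF assms(1)]]]) simp
    ultimately have "fourier g \<xi> = 0"
      by (rule continuous_constant_on_closure[rotated 2]) (use outside in auto)
    then show ?thesis using bandlimited(2) by simp
  qed
  then show "cmod (fourier g \<xi>) \<le> \<tau>0"
    "\<lbrakk>\<alpha> \<le> \<rho>; \<rho> \<le> \<bar>\<xi>\<bar>\<rbrakk> \<Longrightarrow> cmod (fourier g \<xi>) \<le> cmod (fourier g \<rho>)"
    by auto
qed

lemma second_order_taylor_bound:
  fixes f :: "real \<Rightarrow> real"
  assumes "\<And>t. (f has_real_derivative f' t) (at t)" and "\<And>t. (f' has_real_derivative f'' t) (at t)"
    and "\<And>t. \<bar>f'' t\<bar> \<le> C"
  shows "\<bar>f (b + u) - f b - f' b * u\<bar> \<le> C * u\<^sup>2 / 2"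
proof (cases "u = 0")
  case False
  define d where "d = (\<lambda>m::nat. if m = 0 then f else if m = 1 then f' else f'')"
  \<comment> \<open>Taking the minimum and maximum of b and b + u as endpoints lets one instance of
    Taylor's theorem cover both signs of u.\<close>
  have "\<exists>t. (if b + u < b then b + u < t \<and> t < b else b < t \<and> t < b + u) \<and>
      f (b + u) = (\<Sum>m<2. (d m b / fact m) * (b + u - b)^m) + (d 2 t / fact 2) * (b + u - b)^2"
    by (rule Taylor[where a = "min b (b + u)" and b = "max b (b + u)"])
       (use False assms in \<open>auto simp: d_def\<close>)
  then obtain t where "f (b + u) = f b + f' b * u + f'' t / 2 * u\<^sup>2"
    by (auto simp: d_def numeral_2_eq_2)
  then have "\<bar>f (b + u) - f b - f' b * u\<bar> = \<bar>f'' t\<bar> * u\<^sup>2 / 2"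
    by (simp add: abs_mult)
  also have "\<dots> \<le> C * u\<^sup>2 / 2"
    using assms(3)[of t] by (simp add: mult_right_mono)
  finally show ?thesis .
qed auto

text \<open>The signal class bounds amplitudes only almost everywhere. For a continuous function the
  set where the bound fails is open, and a nonempty open set is not null, so the bound holds at
  every point.\<close>

lemma AE_bounded_continuous:
  fixes f :: "real \<Rightarrow> real"
  assumes "continuous_on UNIV f" and "AE t in lborel. f t \<le> C"
  shows "f t \<le> C"
proof (rule ccontr)
  assume "\<not> f t \<le> C"
  then have "t \<in> {s. C < f s}" by simp
  moreover have "open {s. C < f s}"
    using assms(1) by (intro open_Collect_less continuous_on_const)
  moreover have "{s. C < f s} \<in> null_sets lborel"
    using assms(2) \<open>open {s. C < f s}\<close> by (subst (asm) AE_iff_null) (auto simp: not_le)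
  ultimately show False
    using open_not_negligible[of "{s. C < f s}"] negligible_iff_null_sets null_sets_completionI by blast
qed

subsection \<open>Phase transformation and remainder bounds\<close>

lemma C1_differentiable_real:
  fixes f :: "real \<Rightarrow> real"
  assumes "f C1_differentiable_on UNIV"
  shows "(f has_real_derivative deriv f t) (at t)" and "continuous_on UNIV (deriv f)"
proof -
  obtain D where D: "\<And>t. (f has_vector_derivative D t) (at t)" "continuous_on UNIV D"
    using assms by (auto simp: C1_differentiable_on_def)
  then have "deriv f t = D t" for t
    by (auto intro: DERIV_imp_deriv simp: has_real_derivative_iff_has_vector_derivative)
  then have "deriv f = D" by blast
  with D show "(f has_real_derivative deriv f t) (at t)" "continuous_on UNIV (deriv f)"
    by (auto simp: has_real_derivative_iff_has_vector_derivative)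
qed

lemma component_eq: "component A \<phi> k t = of_real (A k t) * cis (2 * pi * \<phi> k t)"
  by (simp only: component_def exp_eq_cis)

lemma component_has_vector_derivative:
  assumes "(A k has_real_derivative A') (at t)" and "(\<phi> k has_real_derivative \<phi>') (at t)"
  shows "(component A \<phi> k has_vector_derivative
    of_real (A k t) * (\<i> * of_real (2 * pi * \<phi>') * cis (2 * pi * \<phi> k t)) + of_real A' * cis (2 * pi * \<phi> k t)) (at t)"
proof -
  have "((\<lambda>t. complex_of_real (A k t)) has_vector_derivative of_real A') (at t)"
    using assms(1) by (intro has_vector_derivative_of_real) (simp add: has_real_derivative_iff_has_vector_derivative)
  moreover have "((\<lambda>t. cis (2 * pi * \<phi> k t)) has_vector_derivative \<i> * of_real (2 * pi * \<phi>') * cis (2 * pi * \<phi> k t)) (at t)"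
    by (rule has_vector_derivative_cis) (auto intro!: derivative_eq_intros assms)
  ultimately show ?thesis
    unfolding component_eq[abs_def] by (rule has_vector_derivative_mult)
qed

text \<open>The time b is fixed once and for all, so differentiability, lower bound and separation
  of \<sigma> are recorded at b. Positivity of \<sigma> is kept at all times because differentiation
  in b evaluates the transform at neighbouring times.\<close>

locale wsst =
  fixes g :: "real \<Rightarrow> complex" and \<sigma> :: "real \<Rightarrow> real"
    and A \<phi> :: "nat \<Rightarrow> real \<Rightarrow> real" and K :: nat and \<mu> \<alpha> \<tau>0 \<epsilon>1 \<epsilon>2 b :: real
  assumes \<mu>_pos: "\<mu> > 0"
    and g: "schwartz g"
    and \<sigma>_pos: "\<sigma> t > 0" and \<sigma>_diff: "\<sigma> differentiable (at b)"
    and bandwidth: "essential_bandwidth g \<alpha> \<tau>0"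
    and \<epsilon>_pos: "\<epsilon>1 > 0" "\<epsilon>2 > 0"
    and signal: "signal_class \<epsilon>1 \<epsilon>2 K A \<phi>"
    and \<sigma>_gt: "\<sigma> b > \<alpha> / \<mu>"
    and \<sigma>_ge: "k \<in> {2..K} \<Longrightarrow> \<sigma> b \<ge> \<alpha> / \<mu> *
      ((deriv (\<phi> k) b + deriv (\<phi> (k - 1)) b) / (deriv (\<phi> k) b - deriv (\<phi> (k - 1)) b))"
begin

abbreviation x where "x \<equiv> signal K A \<phi>"
abbreviation W where "W w a \<equiv> acwt \<mu> \<sigma> w x a b"
abbreviation f where "f k \<equiv> deriv (\<phi> k) b"
abbreviation \<eta> where "\<eta> k a \<equiv> \<sigma> b * (\<mu> - a * f k)"
abbreviation xc where "xc k \<equiv> component A \<phi> k b"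
abbreviation rem where "rem w a \<equiv> remainder \<mu> \<sigma> K A \<phi> w a b"

lemma \<alpha>_pos: "\<alpha> > 0"
  using bandwidth by (simp add: essential_bandwidth_def)

lemma s_pos: "\<sigma> b > 0"
  by (rule \<sigma>_pos)

lemma s_neq_0 [simp]: "\<sigma> b \<noteq> 0"
  using s_pos by (rule less_imp_neq[symmetric])

lemma K_ge_1: "K \<ge> 1"
  using signal by (simp add: signal_class_def)

lemma component_props:
  assumes "k \<in> {1..K}"
  shows "(A k has_real_derivative deriv (A k) t) (at t)" "continuous_on UNIV (deriv (A k))"
    "(\<phi> k has_real_derivative deriv (\<phi> k) t) (at t)" "continuous_on UNIV (deriv (\<phi> k))"
    "(deriv (\<phi> k) has_real_derivative deriv (deriv (\<phi> k)) t) (at t)"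
    "A k t > 0" "deriv (\<phi> k) t > 0" "\<bar>deriv (A k) t\<bar> \<le> \<epsilon>1" "\<bar>deriv (deriv (\<phi> k)) t\<bar> \<le> \<epsilon>2"
    "\<exists>C. \<forall>t. A k t \<le> C" "\<exists>C. \<forall>t. deriv (\<phi> k) t \<le> C"
proof -
  have C1: "A k C1_differentiable_on UNIV" "\<phi> k C1_differentiable_on UNIV" "deriv (\<phi> k) C1_differentiable_on UNIV"
    and bounds: "\<exists>C. AE t in lborel. \<bar>A k t\<bar> \<le> C" "(INF t. ereal (deriv (\<phi> k) t)) > 0"
      "(SUP t. ereal (deriv (\<phi> k) t)) < \<infinity>"
    and pos: "A k t > 0" "\<bar>deriv (A k) t\<bar> \<le> \<epsilon>1" "\<bar>deriv (deriv (\<phi> k)) t\<bar> \<le> \<epsilon>2"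
    using signal assms unfolding signal_class_def by blast+
  note D = C1_differentiable_real[OF C1(1)] C1_differentiable_real[OF C1(2)] C1_differentiable_real[OF C1(3)]
  show "(A k has_real_derivative deriv (A k) t) (at t)" "continuous_on UNIV (deriv (A k))"
    "(\<phi> k has_real_derivative deriv (\<phi> k) t) (at t)" "continuous_on UNIV (deriv (\<phi> k))"
    "(deriv (\<phi> k) has_real_derivative deriv (deriv (\<phi> k)) t) (at t)"
    "A k t > 0" "\<bar>deriv (A k) t\<bar> \<le> \<epsilon>1" "\<bar>deriv (deriv (\<phi> k)) t\<bar> \<le> \<epsilon>2"
    by (fact D pos)+
  have "ereal 0 < ereal (deriv (\<phi> k) t)"
    using bounds(2) INF_lower[of t UNIV "\<lambda>t. ereal (deriv (\<phi> k) t)"]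
    by (metis UNIV_I less_le_trans zero_ereal_def)
  then show "deriv (\<phi> k) t > 0" by simp
  obtain C where "AE t in lborel. \<bar>A k t\<bar> \<le> C" using bounds(1) by blast
  then have "AE t in lborel. A k t \<le> C" by eventually_elim simp
  moreover have "continuous_on UNIV (A k)"
    using D(1) by (auto simp: continuous_on_eq_continuous_at intro: DERIV_isCont)
  ultimately show "\<exists>C. \<forall>t. A k t \<le> C"
    using AE_bounded_continuous by blast
  have "ereal (deriv (\<phi> k) t) \<le> (SUP t. ereal (deriv (\<phi> k) t))" for t
    by (rule SUP_upper) simp
  with bounds(3) show "\<exists>C. \<forall>t. deriv (\<phi> k) t \<le> C"
    by (cases "SUP t. ereal (deriv (\<phi> k) t)") auto
qed

text \<open>A phase may grow without bound, but it enters only through a factor of modulus 1. What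
  enters the derivative is \<phi>_k', A_k and A_k', each of them bounded, so global bounds for x and
  x' exist.\<close>

lemma signal_bounded_C1:
  obtains x' M M' where "\<And>t. (x has_vector_derivative x' t) (at t)" "\<And>t. cmod (x t) \<le> M"
    "\<And>t. cmod (x' t) \<le> M'" "continuous_on UNIV x'"
proof -
  have "\<exists>x' M M'. (\<forall>t. (component A \<phi> k has_vector_derivative x' t) (at t)) \<and>
      (\<forall>t. cmod (component A \<phi> k t) \<le> M) \<and> (\<forall>t. cmod (x' t) \<le> M') \<and> continuous_on UNIV x'"
    if k: "k \<in> {1..K}" for k
  proof -
    note props = component_props[OF k]
    obtain C D where C: "\<And>t. A k t \<le> C" and D: "\<And>t. deriv (\<phi> k) t \<le> D"
      using props(10,11) by blast
    let ?x' = "\<lambda>t. of_real (A k t) * (\<i> * of_real (2 * pi * deriv (\<phi> k) t) * cis (2 * pi * \<phi> k t))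
      + of_real (deriv (A k) t) * cis (2 * pi * \<phi> k t)"
    have "cmod (?x' t) \<le> C * (2 * pi * D) + \<epsilon>1" for t
    proof -
      have "cmod (?x' t) \<le> A k t * (2 * pi * deriv (\<phi> k) t) + \<bar>deriv (A k) t\<bar>"
        using props(6,7)[of t] by (intro order_trans[OF norm_triangle_ineq]) (simp add: norm_mult)
      also have "\<dots> \<le> C * (2 * pi * D) + \<epsilon>1"
        using props(6,7)[of t] props(8)[of t] C[of t] D[of t]
        by (intro add_mono mult_mono) auto
      finally show ?thesis .
    qed
    moreover have "(component A \<phi> k has_vector_derivative ?x' t) (at t)" for t
      by (intro component_has_vector_derivative props)
    moreover have "cmod (component A \<phi> k t) \<le> C" for t
      using C[of t] props(6)[of t] by (simp add: component_eq norm_mult)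
    moreover have "continuous_on UNIV ?x'"
      using props(2,4) DERIV_continuous_on[OF props(1)] DERIV_continuous_on[OF props(3)]
      by (intro continuous_intros) auto
    ultimately show ?thesis by (intro exI[of _ ?x'] exI conjI) auto
  qed
  then obtain x' M M' where
    *: "\<And>k t. k \<in> {1..K} \<Longrightarrow> (component A \<phi> k has_vector_derivative x' k t) (at t)"
      "\<And>k t. k \<in> {1..K} \<Longrightarrow> cmod (component A \<phi> k t) \<le> M k"
      "\<And>k t. k \<in> {1..K} \<Longrightarrow> cmod (x' k t) \<le> M' k"
      "\<And>k. k \<in> {1..K} \<Longrightarrow> continuous_on UNIV (x' k)"
    by metis
  show ?thesis
  proof (rule that[of "\<lambda>t. \<Sum>k=1..K. x' k t" "\<Sum>k=1..K. M k" "\<Sum>k=1..K. M' k"])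
    show "(x has_vector_derivative (\<Sum>k=1..K. x' k t)) (at t)" for t
      unfolding signal_def[abs_def] by (intro has_vector_derivative_sum *)
    show "continuous_on UNIV (\<lambda>t. \<Sum>k=1..K. x' k t)"
      by (intro continuous_on_sum *)
    show "cmod (x t) \<le> (\<Sum>k=1..K. M k)" for t
      unfolding signal_def by (intro sum_norm_le *)
    show "cmod (\<Sum>k=1..K. x' k t) \<le> (\<Sum>k=1..K. M' k)" for t
      by (intro sum_norm_le *)
  qed
qed

lemma W_continuous:
  assumes "schwartz w"
  shows "continuous_on UNIV (W w)"
proof -
  obtain x' M M' where "\<And>t. (x has_vector_derivative x' t) (at t)" "\<And>t. cmod (x t) \<le> M"
    "\<And>t. cmod (x' t) \<le> M'" "continuous_on UNIV x'"
    by (rule signal_bounded_C1) blast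
  then show ?thesis
    by (intro acwt_continuous_scale[where M = M] schwartz_integrable assms s_pos)
       (auto simp: continuous_on_eq_continuous_at intro: has_vector_derivative_continuous)
qed

text \<open>Beyond its role in (b), this closed form involves only transforms at the fixed time b
  and no derivative in b; this is what makes measurability of the phase in a accessible.\<close>

lemma phase_c_eq:
  assumes "a > 0" and "W g a \<noteq> 0"
  shows "phase_c \<mu> \<sigma> g x a b = of_real (\<mu> / a) - W (vderiv g) a / (\<i> * of_real (2 * pi) * of_real (a * \<sigma> b) * W g a)"
proof -
  obtain x' M M' where x: "\<And>t. (x has_vector_derivative x' t) (at t)" "\<And>t. cmod (x t) \<le> M"
    "\<And>t. cmod (x' t) \<le> M'" "continuous_on UNIV x'"
    by (rule signal_bounded_C1) blast
  have "(\<sigma> has_real_derivative deriv \<sigma> b) (at b)"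
    using \<sigma>_diff by (simp add: DERIV_deriv_iff_real_differentiable)
  from vector_derivative_at[OF acwt_has_vector_derivative[OF x g \<sigma>_pos this assms(1), of \<mu>]]
  show ?thesis
    using assms s_pos by (simp add: phase_c_def Let_def divide_simps) (simp add: algebra_simps)
qed

text \<open>As \<eta>_l = a \<sigma>(b) (\<mu>/a - \<phi>_l'), the main terms of the g'-transform
  are those of the g-transform weighted by \<mu>/a - \<phi>_l'. Comparing them with the common
  weight \<mu>/a - \<phi>_k' leaves \<phi>_l' - \<phi>_k', so the k-th term drops out. The argument
  is exact algebra, without any estimate.\<close>

lemma phase_c_diff:
  assumes a: "a > 0" and W: "W g a \<noteq> 0" and k: "k \<in> {1..K}"
  shows "phase_c \<mu> \<sigma> g x a b - of_real (f k) = Rem1 \<mu> \<sigma> g K A \<phi> k a b / (\<i> * of_real (2 * pi) * W g a)"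
proof -
  define F where "F = (\<lambda>l. fourier g (\<eta> l a))"
  define X Y C where "X = (\<Sum>l=1..K. xc l * F l)" and "Y = (\<Sum>l=1..K. of_real (\<mu> / a - f l) * (xc l * F l))"
    and "C = (\<Sum>l\<in>{1..K} - {k}. xc l * of_real (f l - f k) * F l)"
  define c where "c = complex_of_real (a * \<sigma> b)"
  have c: "c \<noteq> 0" using a by (simp add: c_def)
  have F': "fourier (vderiv g) (\<eta> l a) = \<i> * of_real (2 * pi) * c * of_real (\<mu> / a - f l) * F l" for l
  proof -
    have "\<eta> l a = a * \<sigma> b * (\<mu> / a - f l)" using a by (simp add: field_simps)
    then have "complex_of_real (2 * pi * \<eta> l a) = of_real (2 * pi) * c * of_real (\<mu> / a - f l)"
      by (simp only: c_def of_real_mult mult.assoc)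
    then show ?thesis by (simp only: F_def fourier_vderiv[OF g] mult.assoc)
  qed
  have rem: "rem g a = W g a - X"
    by (simp add: remainder_def F_def X_def)
  have "(\<Sum>l=1..K. xc l * fourier (vderiv g) (\<eta> l a)) = \<i> * of_real (2 * pi) * c * Y"
    unfolding F' Y_def sum_distrib_left by (intro sum.cong refl) (simp add: mult_ac)
  then have rem': "rem (vderiv g) a = W (vderiv g) a - \<i> * of_real (2 * pi) * c * Y"
    by (simp add: remainder_def)
  have "C = (\<Sum>l=1..K. xc l * of_real (f l - f k) * F l)"
    unfolding C_def by (rule sum.mono_neutral_left) auto
  also have "\<dots> = (\<Sum>l=1..K. of_real (\<mu> / a - f k) * (xc l * F l) - of_real (\<mu> / a - f l) * (xc l * F l))"
    by (intro sum.cong refl) (simp add: algebra_simps)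
  also have "\<dots> = of_real (\<mu> / a - f k) * X - Y"
    by (simp only: sum_subtractf sum_distrib_left X_def Y_def)
  finally have cross: "C = of_real (\<mu> / a - f k) * X - Y" .
  have "Rem1 \<mu> \<sigma> g K A \<phi> k a b = \<i> * of_real (2 * pi) * of_real (\<mu> / a - f k) * rem g a
      - rem (vderiv g) a / c + \<i> * of_real (2 * pi) * C"
    by (simp only: Rem1_def C_def F_def c_def)
  also have "\<dots> = \<i> * of_real (2 * pi) * of_real (\<mu> / a - f k) * W g a - W (vderiv g) a / c"
  proof -
    have "\<i> * d * m * (V - X) - (V' - \<i> * d * c * Y) / c + \<i> * d * (m * X - Y) = \<i> * d * m * V - V' / c"
      for d m V V' :: complex
      using c by (simp add: field_simps)
    then show ?thesis unfolding rem rem' cross .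
  qed
  finally show ?thesis
    using c W unfolding phase_c_eq[OF a W] c_def[symmetric] of_real_diff
    by (simp add: divide_simps) (simp add: algebra_simps)
qed

section \<open>Linearised components and the size of the remainder\<close>

lemma component_linearization:
  assumes k: "k \<in> {1..K}"
  shows "cmod (component A \<phi> k (b + u) - xc k * cis (2 * pi * f k * u)) \<le> \<epsilon>1 * \<bar>u\<bar> + pi * \<epsilon>2 * A k b * u\<^sup>2"
proof -
  note props = component_props[OF k]
  let ?p = "cis (2 * pi * \<phi> k (b + u))" and ?q = "cis (2 * pi * \<phi> k b + 2 * pi * f k * u)"
  have "norm (A k (b + u) - A k b) \<le> \<epsilon>1 * \<bar>b + u - b\<bar>"
    by (rule norm_diff_le_derivative_bound[where f' = "deriv (A k)"])
       (use props(1,8) in \<open>auto simp: has_real_derivative_iff_has_vector_derivative\<close>)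
  then have 1: "\<bar>A k (b + u) - A k b\<bar> \<le> \<epsilon>1 * \<bar>u\<bar>" by simp
  have "cmod (?p - ?q) \<le> \<bar>2 * pi * \<phi> k (b + u) - (2 * pi * \<phi> k b + 2 * pi * f k * u)\<bar>"
    by (rule norm_cis_diff_le)
  also have "\<dots> = \<bar>2 * pi * (\<phi> k (b + u) - \<phi> k b - f k * u)\<bar>"
    by (simp add: algebra_simps)
  also have "\<dots> = 2 * pi * \<bar>\<phi> k (b + u) - \<phi> k b - f k * u\<bar>"
    by (simp add: abs_mult)
  also have "\<dots> \<le> 2 * pi * (\<epsilon>2 * u\<^sup>2 / 2)"
    by (intro mult_left_mono second_order_taylor_bound[OF props(3,5,9)]) simp
  finally have 2: "cmod (?p - ?q) \<le> pi * \<epsilon>2 * u\<^sup>2" by simp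
  \<comment> \<open>The amplitude increment is paired with the true exponential, of modulus 1, and
    the phase error with the amplitude at b. In this splitting only \<open>A k b\<close> enters the
    bound, not the amplitude at b + u.\<close>
  have "component A \<phi> k (b + u) - xc k * cis (2 * pi * f k * u)
      = of_real (A k (b + u) - A k b) * ?p + of_real (A k b) * (?p - ?q)"
    by (simp add: component_eq algebra_simps flip: cis_mult)
  also have "cmod \<dots> \<le> \<bar>A k (b + u) - A k b\<bar> + A k b * cmod (?p - ?q)"
    using props(6)[of b] by (intro order_trans[OF norm_triangle_ineq]) (simp add: norm_mult flip: of_real_diff)
  also have "\<dots> \<le> \<epsilon>1 * \<bar>u\<bar> + A k b * (pi * \<epsilon>2 * u\<^sup>2)"
    using props(6)[of b] by (intro add_mono mult_left_mono 1 2) auto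
  finally show ?thesis by (simp add: mult_ac)
qed

text \<open>The linearisation error is used at u = a \<sigma>(b) s: its powers of |s| turn into
  absolute moments of w, and each power brings one factor a \<sigma>(b).\<close>

lemma remainder_bound:
  assumes w: "schwartz w" and a: "a > 0"
  shows "cmod (rem w a) \<le> a * \<sigma> b * (K * \<epsilon>1 * abs_moment 1 w
    + pi * \<epsilon>2 * abs_moment 2 w * (a * \<sigma> b) * (\<Sum>k=1..K. A k b))"
proof -
  define c d where "c = a * \<sigma> b" and "d = - (2 * pi * \<mu> * \<sigma> b)"
  have c: "c > 0" using a s_pos by (simp add: c_def)
  have cont: "continuous_on UNIV (component A \<phi> k)" if "k \<in> {1..K}" for k
    unfolding continuous_on_eq_continuous_at[OF open_UNIV]
    by (intro ballI has_vector_derivative_continuous[OF component_has_vector_derivative[where A = A and \<phi> = \<phi>,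
        OF component_props(1,3)[OF that]]])
  define D where "D = (\<lambda>k s. component A \<phi> k (b + c * s) - xc k * cis (2 * pi * f k * (c * s)))"
  have int1: "integrable lborel (\<lambda>s. component A \<phi> k (b + c * s) * cis (d * s) * w s)" if k: "k \<in> {1..K}" for k
  proof -
    obtain C where C: "\<And>t. A k t \<le> C" using component_props(10)[OF k] by blast
    have "cmod (component A \<phi> k t) \<le> C" for t
      using C[of t] component_props(6)[OF k, of t] by (simp add: component_eq norm_mult)
    then show ?thesis
      by (intro acwt_integrand_integrable cont k schwartz_integrable w)
  qed
  \<comment> \<open>A linearised component times the modulation is a pure exponential of frequency
    -\<eta>_k(a). Its integral against w is therefore exactly the Fourier term subtracted in
    \<open>remainder\<close>.\<close>
  have lin: "xc k * cis (2 * pi * f k * (c * s)) * cis (d * s) * w s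
      = xc k * (cis (- (2 * pi * \<eta> k a * s)) * w s)" for k s
    by (simp add: c_def d_def cis_mult algebra_simps)
  have int2: "integrable lborel (\<lambda>s. xc k * (cis (- (2 * pi * \<eta> k a * s)) * w s))" for k
    using schwartz_integrable[OF w]
    by (intro integrable_mult_right integrable_bounded_mult[where M = 1] borel_measurable_continuous_onI
        continuous_intros) auto
  have "W w a = (LBINT s. \<Sum>k=1..K. component A \<phi> k (b + c * s) * cis (d * s) * w s)"
    unfolding acwt_rescale[of \<sigma>, OF s_pos] by (simp add: c_def d_def signal_def sum_distrib_right)
  also have "\<dots> = (\<Sum>k=1..K. LBINT s. component A \<phi> k (b + c * s) * cis (d * s) * w s)"
    by (rule Bochner_Integration.integral_sum) (rule int1)
  finally have "rem w a = (\<Sum>k=1..K. (LBINT s. component A \<phi> k (b + c * s) * cis (d * s) * w s)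
      - (LBINT s. xc k * cis (2 * pi * f k * (c * s)) * cis (d * s) * w s))"
    unfolding lin by (simp add: remainder_def fourier_eq sum_subtractf)
  also have "\<dots> = (\<Sum>k=1..K. LBINT s. D k s * cis (d * s) * w s)"
    using int2 unfolding lin[symmetric]
    by (intro sum.cong refl) (simp add: D_def left_diff_distrib int1)
  also have "cmod \<dots> \<le> (\<Sum>k=1..K. \<epsilon>1 * c * abs_moment 1 w + pi * \<epsilon>2 * A k b * c\<^sup>2 * abs_moment 2 w)"
  proof (rule sum_norm_le)
    fix k assume k: "k \<in> {1..K}"
    have intB: "integrable lborel (\<lambda>s. \<epsilon>1 * c * cmod (of_real (s ^ 1) * w s)
        + pi * \<epsilon>2 * A k b * c\<^sup>2 * cmod (of_real (s ^ 2) * w s))" (is "integrable _ ?B")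
      using schwartz_moment_integrable[OF w, of 1] schwartz_moment_integrable[OF w, of 2]
      by (intro Bochner_Integration.integrable_add integrable_mult_right integrable_norm)
    have intD: "integrable lborel (\<lambda>s. D k s * cis (d * s) * w s)"
    proof -
      have "integrable lborel (\<lambda>s. component A \<phi> k (b + c * s) * cis (d * s) * w s
          - xc k * cis (2 * pi * f k * (c * s)) * cis (d * s) * w s)"
        unfolding lin by (intro Bochner_Integration.integrable_diff int1 int2 k)
      then show ?thesis
        by (simp add: D_def left_diff_distrib)
    qed
    have bound: "norm (D k s * cis (d * s) * w s) \<le> ?B s" for s
    proof -
      have "cmod (D k s) * cmod (w s) \<le> (\<epsilon>1 * \<bar>c * s\<bar> + pi * \<epsilon>2 * A k b * (c * s)\<^sup>2) * cmod (w s)"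
        unfolding D_def by (intro mult_right_mono component_linearization k) simp
      then show ?thesis
        using c by (simp add: norm_mult norm_power algebra_simps abs_mult power_mult_distrib)
    qed
    have "cmod (LBINT s. D k s * cis (d * s) * w s) \<le> (LBINT s. ?B s)"
      by (rule Bochner_Integration.integral_norm_bound_integral[OF intD intB bound])
    also have "\<dots> = \<epsilon>1 * c * abs_moment 1 w + pi * \<epsilon>2 * A k b * c\<^sup>2 * abs_moment 2 w"
      unfolding abs_moment_def
      using schwartz_moment_integrable[OF w, of 1] schwartz_moment_integrable[OF w, of 2]
      by (subst Bochner_Integration.integral_add) auto
    finally show "cmod (LBINT s. D k s * cis (d * s) * w s) \<le> \<dots>" .
  qed
  also have "\<dots> = c * (K * \<epsilon>1 * abs_moment 1 w + pi * \<epsilon>2 * abs_moment 2 w * c * (\<Sum>k=1..K. A k b))"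
    by (simp add: sum.distrib sum_distrib_left sum_distrib_right algebra_simps power2_eq_square)
  finally show ?thesis by (simp add: c_def)
qed

section \<open>Zones as ordered intervals of scales\<close>

abbreviation \<Lambda> where "\<Lambda> w k \<equiv> err_bound \<mu> \<sigma> \<alpha> \<epsilon>1 \<epsilon>2 K A \<phi> w k b"
abbreviation amin where "amin \<equiv> scale_min \<mu> \<sigma> \<alpha> K \<phi> b"
abbreviation amax where "amax \<equiv> scale_max \<mu> \<sigma> \<alpha> \<phi> b"
abbreviation zmin where "zmin k \<equiv> (\<mu> - \<alpha> / \<sigma> b) / f k"
abbreviation zmax where "zmax k \<equiv> (\<mu> + \<alpha> / \<sigma> b) / f k"

lemma f_pos: "k \<in> {1..K} \<Longrightarrow> f k > 0"
  by (rule component_props(7))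

lemma \<mu>_\<alpha>: "\<mu> - \<alpha> / \<sigma> b > 0" "\<mu> + \<alpha> / \<sigma> b > 0" "\<mu> * \<sigma> b > \<alpha>"
proof -
  show "\<mu> * \<sigma> b > \<alpha>"
    using \<sigma>_gt \<mu>_pos by (simp add: field_simps)
  then show "\<mu> - \<alpha> / \<sigma> b > 0"
    using s_pos by (simp add: field_simps)
  show "\<mu> + \<alpha> / \<sigma> b > 0"
    using \<mu>_pos \<alpha>_pos s_pos by (simp add: add_pos_pos)
qed

lemma f_less:
  assumes "l < k" "l \<in> {1..K}" "k \<in> {1..K}"
  shows "f l < f k"
  using assms
proof (induction k)
  case (Suc k)
  have step: "f k < f (Suc k)" if "k \<ge> 1"
    using signal Suc.prems that unfolding signal_class_def by (auto dest!: bspec[where x = "Suc k"])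
  show ?case
  proof (cases "l = k")
    case False
    then have "f l < f k" using Suc by auto
    with step Suc.prems False show ?thesis by auto
  qed (use step Suc.prems in auto)
qed simp

lemma f_mono: "\<lbrakk>l \<le> k; l \<in> {1..K}; k \<in> {1..K}\<rbrakk> \<Longrightarrow> f l \<le> f k"
  using f_less[of l k] by (cases "l = k") auto

text \<open>For neighbouring indices this is the lower bound on \<sigma>(b) with its denominators
  cleared; monotonicity of the frequencies carries it over to all l < k.\<close>

lemma separation:
  assumes "l < k" "l \<in> {1..K}" "k \<in> {1..K}"
  shows "(\<mu> * \<sigma> b + \<alpha>) * f l \<le> (\<mu> * \<sigma> b - \<alpha>) * f k"
proof -
  have k: "k \<in> {2..K}" "k - 1 \<in> {1..K}" using assms by auto
  define p q where "p = f (k - 1)" and "q = f k"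
  have "p < q" using f_less[of "k - 1" k] k assms by (auto simp: p_def q_def)
  have "\<alpha> / \<mu> * ((q + p) / (q - p)) \<le> \<sigma> b"
    using \<sigma>_ge[OF k(1)] by (simp add: p_def q_def)
  then have "\<alpha> * (q + p) \<le> \<sigma> b * (\<mu> * (q - p))"
    using \<open>p < q\<close> \<mu>_pos by (simp add: field_simps)
  then have "(\<mu> * \<sigma> b + \<alpha>) * p \<le> (\<mu> * \<sigma> b - \<alpha>) * q"
    by (simp add: algebra_simps)
  moreover have "(\<mu> * \<sigma> b + \<alpha>) * f l \<le> (\<mu> * \<sigma> b + \<alpha>) * p"
    using f_mono[of l "k - 1"] assms k \<mu>_\<alpha>(3) \<alpha>_pos by (intro mult_left_mono) (auto simp: p_def)
  ultimately show ?thesis by (simp add: q_def)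
qed

lemma zone_iff: "k \<in> {1..K} \<Longrightarrow> (a, b) \<in> zone \<mu> \<sigma> \<alpha> \<phi> k \<longleftrightarrow> a \<in> {zmin k<..<zmax k}"
  using f_pos[of k] by (auto simp: zone_def abs_less_iff pos_divide_less_eq pos_less_divide_eq)

text \<open>Higher frequencies live at smaller scales, so the zones appear in reversed order.
  Equality is possible, but the zones are open intervals and stay disjoint when they share an
  endpoint.\<close>

lemma zmax_le_zmin:
  assumes "l < k" "l \<in> {1..K}" "k \<in> {1..K}"
  shows "zmax k \<le> zmin l"
proof -
  have pos: "f l > 0" "f k > 0" using f_pos assms by auto
  have "(\<mu> + \<alpha> / \<sigma> b) * f l = (\<mu> * \<sigma> b + \<alpha>) * f l / \<sigma> b"
    by (simp add: field_simps)
  also have "\<dots> \<le> (\<mu> * \<sigma> b - \<alpha>) * f k / \<sigma> b"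
    using separation[OF assms] s_pos by (intro divide_right_mono) auto
  also have "\<dots> = (\<mu> - \<alpha> / \<sigma> b) * f k"
    by (simp add: field_simps)
  finally show ?thesis
    using pos by (simp add: pos_divide_le_eq pos_le_divide_eq)
qed

lemma zone_unique:
  assumes "k \<in> {1..K}" "l \<in> {1..K}" "(a, b) \<in> zone \<mu> \<sigma> \<alpha> \<phi> k" "(a, b) \<in> zone \<mu> \<sigma> \<alpha> \<phi> l"
  shows "l = k"
  using zmax_le_zmin[of l k] zmax_le_zmin[of k l] assms
  by (cases l k rule: linorder_cases) (auto simp: zone_iff)

lemma zone_subset_scales:
  assumes "k \<in> {1..K}"
  shows "amin \<le> zmin k" "zmax k \<le> amax" "zmin k < zmax k" "zmin k > 0"
proof -
  have 1: "f 1 \<le> f k" "f k \<le> f K" using f_mono[of 1 k] f_mono[of k K] assms K_ge_1 by auto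
  have pos: "f 1 > 0" "f K > 0" using f_pos K_ge_1 by auto
  show "amin \<le> zmin k"
    unfolding scale_min_def using 1 \<mu>_\<alpha> f_pos[OF assms] by (intro divide_left_mono) auto
  show "zmax k \<le> amax"
    unfolding scale_max_def using 1 \<mu>_\<alpha> f_pos[OF assms] pos by (intro divide_left_mono) auto
  show "zmin k > 0" using \<mu>_\<alpha> f_pos[OF assms] by simp
  show "zmin k < zmax k"
    using f_pos[OF assms] \<alpha>_pos s_pos by (intro divide_strict_right_mono) (auto simp: add_pos_pos less_le_trans[of _ 0])
qed

lemma amin_pos: "amin > 0"
  unfolding scale_min_def using \<mu>_\<alpha>(1) f_pos[of K] K_ge_1 by simp

lemma abs_moment_nonneg: "abs_moment n w \<ge> 0"
  unfolding abs_moment_def by (rule integral_nonneg_AE) simp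

lemma amplitude_sum_nonneg: "(\<Sum>j=1..K. A j b) \<ge> 0"
  by (rule sum_nonneg) (use component_props(6) less_imp_le in blast)

text \<open>The upper end of the zone turns one factor a \<sigma>(b) into (\<mu> \<sigma>(b) +
  \<alpha>) / \<phi>_k'(b), the quantity in \<open>err_bound\<close>. For k = 1 this end is
  \<open>amax\<close>, so the estimate then covers the whole range of scales; hence \<Lambda>_1 in
  (a).\<close>

lemma remainder_bound_zone:
  assumes w: "schwartz w" and k: "k \<in> {1..K}" and a: "a > 0" "a \<le> zmax k"
  shows "cmod (rem w a) \<le> a * \<sigma> b * \<Lambda> w k"
proof -
  have "a * \<sigma> b \<le> zmax k * \<sigma> b"
    using s_pos by (intro mult_right_mono a) simp
  also have "\<dots> = (\<mu> * \<sigma> b + \<alpha>) / f k"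
    by (simp add: distrib_right)
  finally have le: "a * \<sigma> b \<le> (\<mu> * \<sigma> b + \<alpha>) / f k" .
  have "pi * \<epsilon>2 * abs_moment 2 w * (a * \<sigma> b) * (\<Sum>j=1..K. A j b)
      \<le> pi * \<epsilon>2 * abs_moment 2 w * ((\<mu> * \<sigma> b + \<alpha>) / f k) * (\<Sum>j=1..K. A j b)"
    using le \<epsilon>_pos abs_moment_nonneg amplitude_sum_nonneg by (intro mult_right_mono mult_left_mono) auto
  then have "a * \<sigma> b * (K * \<epsilon>1 * abs_moment 1 w + pi * \<epsilon>2 * abs_moment 2 w * (a * \<sigma> b) * (\<Sum>j=1..K. A j b))
      \<le> a * \<sigma> b * \<Lambda> w k"
    unfolding err_bound_def using a s_pos by (intro mult_left_mono) auto
  with remainder_bound[OF w a(1)] show ?thesis by linarith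
qed

lemma err_bound_nonneg:
  assumes "k \<in> {1..K}"
  shows "\<Lambda> w k \<ge> 0"
proof -
  note abs_moment_nonneg[of _ w]
  moreover note amplitude_sum_nonneg
  ultimately show ?thesis
    unfolding err_bound_def using \<epsilon>_pos \<mu>_\<alpha> \<alpha>_pos \<mu>_pos s_pos f_pos[OF assms]
    by (intro add_nonneg_nonneg mult_nonneg_nonneg divide_nonneg_nonneg) auto
qed

text \<open>If the first absolute moment vanished, g would be zero almost everywhere and so would
  every transform value. Positivity is the source of the strict inequality in (b): dividing by |W| >
  e1 gives a strict gain only if the numerator is positive.\<close>

lemma err_bound_pos:
  assumes "k \<in> {1..K}" and "W g a \<noteq> 0"
  shows "\<Lambda> g k > 0"
proof -
  have int: "integrable lborel (\<lambda>t. cmod (of_real (t ^ 1) * g t))"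
    by (intro integrable_norm schwartz_moment_integrable g)
  have "abs_moment 1 g \<noteq> 0"
  proof
    assume "abs_moment 1 g = 0"
    then have "AE t in lborel. cmod (of_real (t ^ 1) * g t) = 0"
      unfolding abs_moment_def using integral_nonneg_eq_0_iff_AE[OF int] by auto
    moreover have "AE t in lborel. t \<noteq> (0::real)"
      by (rule AE_lborel_singleton)
    ultimately have "AE t in lborel. g t = 0"
      by eventually_elim auto
    then have "W g a = 0"
      unfolding acwt_rescale[of \<sigma>, OF s_pos] by (intro integral_eq_zero_AE) (auto elim: eventually_mono)
    with assms show False by simp
  qed
  moreover note abs_moment_nonneg[of _ g]
  ultimately have "abs_moment 1 g > 0" "abs_moment 2 g \<ge> 0"
    by (metis less_eq_real_def)+
  moreover note amplitude_sum_nonneg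
  ultimately show ?thesis
    unfolding err_bound_def using \<epsilon>_pos \<mu>_\<alpha> \<alpha>_pos f_pos[OF assms(1)] K_ge_1
    by (intro add_pos_nonneg mult_pos_pos mult_nonneg_nonneg divide_nonneg_nonneg) auto
qed

section \<open>Localisation in one zone and the phase estimate\<close>

lemma cmod_xc: "k \<in> {1..K} \<Longrightarrow> cmod (xc k) = A k b"
  using component_props(6)[of k b] by (simp add: component_eq norm_mult)

text \<open>Outside all zones every |\<eta>_k(a)| is at least \<alpha>, so each main term is at most
  \<tau>0 A_k(b). Together with the remainder estimate at \<open>amax\<close> this keeps |W| at or
  below e1.\<close>

lemma zone_exists_unique:
  assumes thr: "threshold_cond \<mu> \<sigma> g \<alpha> \<tau>0 \<epsilon>1 \<epsilon>2 K A \<phi> e1 b"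
    and a: "a \<in> {amin..amax}" and W: "cmod (W g a) > e1"
  shows "\<exists>!k. k \<in> {1..K} \<and> (a, b) \<in> zone \<mu> \<sigma> \<alpha> \<phi> k"
proof -
  have "\<exists>k\<in>{1..K}. (a, b) \<in> zone \<mu> \<sigma> \<alpha> \<phi> k"
  proof (rule ccontr)
    assume none: "\<not> (\<exists>k\<in>{1..K}. (a, b) \<in> zone \<mu> \<sigma> \<alpha> \<phi> k)"
    have a_pos: "a > 0" using a amin_pos by simp
    have "cmod (fourier g (\<eta> k a)) \<le> \<tau>0" if "k \<in> {1..K}" for k
    proof (rule essential_bandwidth_fourier_le(1)[OF g bandwidth])
      have "\<not> \<bar>\<mu> - a * f k\<bar> < \<alpha> / \<sigma> b" using none that by (auto simp: zone_def)
      then have "\<alpha> / \<sigma> b \<le> \<bar>\<mu> - a * f k\<bar>" by simp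
      then have "\<alpha> \<le> \<sigma> b * \<bar>\<mu> - a * f k\<bar>" using s_pos by (simp add: field_simps)
      then show "\<alpha> \<le> \<bar>\<eta> k a\<bar>" using s_pos by (simp add: abs_mult)
    qed
    then have "cmod (\<Sum>k=1..K. xc k * fourier g (\<eta> k a)) \<le> (\<Sum>k=1..K. A k b * \<tau>0)"
      using component_props(6) less_imp_le by (intro sum_norm_le) (auto simp: norm_mult cmod_xc intro!: mult_left_mono)
    also have "\<dots> = \<tau>0 * (\<Sum>k=1..K. A k b)" by (simp add: sum_distrib_left mult.commute)
    finally have 1: "cmod (\<Sum>k=1..K. xc k * fourier g (\<eta> k a)) \<le> \<tau>0 * (\<Sum>k=1..K. A k b)" .
    have "cmod (rem g a) \<le> a * \<sigma> b * \<Lambda> g 1"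
      using a a_pos K_ge_1 by (intro remainder_bound_zone g) (auto simp: scale_max_def)
    also have "\<dots> \<le> amax * \<sigma> b * \<Lambda> g 1"
      using a err_bound_nonneg[of 1 g] K_ge_1 s_pos by (intro mult_right_mono) auto
    finally have 2: "cmod (rem g a) \<le> amax * \<sigma> b * \<Lambda> g 1" .
    have "W g a = rem g a + (\<Sum>k=1..K. xc k * fourier g (\<eta> k a))"
      by (simp add: remainder_def)
    then have "cmod (W g a) \<le> cmod (rem g a) + cmod (\<Sum>k=1..K. xc k * fourier g (\<eta> k a))"
      by (metis norm_triangle_ineq)
    with 1 2 thr W show False by (simp add: threshold_cond_def)
  qed
  then show ?thesis using zone_unique by blast
qed

text \<open>The number \<rho> is |\<eta>_l| at the end of Z_k nearest in frequency to component l: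
  the upper end for l < k, the lower end for l > k. There |\<eta>_l| is smallest over the zone, and
  the separation of frequencies keeps it at or above \<alpha>.\<close>

lemma rho_bounds:
  assumes k: "k \<in> {1..K}" and l: "l \<in> {1..K}" "l \<noteq> k" and a: "(a, b) \<in> zone \<mu> \<sigma> \<alpha> \<phi> k"
  shows "\<alpha> \<le> rho \<mu> \<sigma> \<alpha> \<phi> l k b" "rho \<mu> \<sigma> \<alpha> \<phi> l k b \<le> \<bar>\<eta> l a\<bar>"
proof -
  have pos: "f k > 0" "f l > 0" using k l f_pos by auto
  have a': "zmin k < a" "a < zmax k" using a zone_iff[OF k] by auto
  have "\<alpha> \<le> rho \<mu> \<sigma> \<alpha> \<phi> l k b \<and> rho \<mu> \<sigma> \<alpha> \<phi> l k b \<le> \<bar>\<eta> l a\<bar>"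
  proof (cases "l < k")
    case True
    define r where "r = (\<sigma> b * \<mu> + \<alpha>) * (f l / f k)"
    have "a * \<sigma> b \<le> (\<sigma> b * \<mu> + \<alpha>) / f k" using a' s_pos pos by (simp add: field_simps)
    then have "a * \<sigma> b * f l \<le> (\<sigma> b * \<mu> + \<alpha>) / f k * f l" using pos by (intro mult_right_mono) auto
    then have "a * \<sigma> b * f l \<le> r" by (simp add: r_def)
    moreover have "r \<le> \<sigma> b * \<mu> - \<alpha>"
      using separation[OF True] k l pos by (simp add: r_def field_simps)
    moreover have "\<eta> l a = \<sigma> b * \<mu> - a * \<sigma> b * f l" by (simp add: algebra_simps)
    moreover have "rho \<mu> \<sigma> \<alpha> \<phi> l k b = \<sigma> b * \<mu> - r"
      using True by (simp add: rho_def r_def)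
    ultimately show ?thesis by linarith
  next
    case False
    then have gt: "k < l" using l by simp
    define r where "r = (\<sigma> b * \<mu> - \<alpha>) * (f l / f k)"
    have "(\<sigma> b * \<mu> - \<alpha>) / f k \<le> a * \<sigma> b" using a' s_pos pos by (simp add: field_simps)
    then have "(\<sigma> b * \<mu> - \<alpha>) / f k * f l \<le> a * \<sigma> b * f l" using pos by (intro mult_right_mono) auto
    then have "r \<le> a * \<sigma> b * f l" by (simp add: r_def)
    moreover have "\<sigma> b * \<mu> + \<alpha> \<le> r"
      using separation[OF gt] k l pos by (simp add: r_def field_simps)
    moreover have "\<eta> l a = \<sigma> b * \<mu> - a * \<sigma> b * f l" by (simp add: algebra_simps)
    moreover have "rho \<mu> \<sigma> \<alpha> \<phi> l k b = r - \<sigma> b * \<mu>"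
      using False by (simp add: rho_def r_def)
    ultimately show ?thesis by linarith
  qed
  then show "\<alpha> \<le> rho \<mu> \<sigma> \<alpha> \<phi> l k b" "rho \<mu> \<sigma> \<alpha> \<phi> l k b \<le> \<bar>\<eta> l a\<bar>" by auto
qed

lemma phase_error:
  assumes k: "k \<in> {1..K}" and e1: "e1 > 0" and a: "(a, b) \<in> zone \<mu> \<sigma> \<alpha> \<phi> k"
    and W: "cmod (W g a) > e1"
  shows "\<bar>phase \<mu> \<sigma> g x a b - f k\<bar> < bd \<mu> \<sigma> g \<alpha> \<epsilon>1 \<epsilon>2 K A \<phi> e1 k b"
proof -
  have a': "zmin k < a" "a < zmax k" using a zone_iff[OF k] by auto
  then have a_pos: "a > 0" using zone_subset_scales(4)[OF k] by simp
  have W0: "W g a \<noteq> 0" using W e1 by auto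
  define S where "S = (\<Sum>l\<in>{1..K} - {k}. A l b * \<bar>f l - f k\<bar> * cmod (fourier g (rho \<mu> \<sigma> \<alpha> \<phi> l k b)))"
  define B where "B = \<alpha> * \<Lambda> g k + 1 / (2 * pi) * \<Lambda> (vderiv g) k + S"
  have S: "cmod (\<Sum>l\<in>{1..K} - {k}. xc l * of_real (f l - f k) * fourier g (\<eta> l a)) \<le> S"
    unfolding S_def
  proof (rule sum_norm_le)
    fix l assume l: "l \<in> {1..K} - {k}"
    have "cmod (fourier g (\<eta> l a)) \<le> cmod (fourier g (rho \<mu> \<sigma> \<alpha> \<phi> l k b))"
      using rho_bounds[OF k _ _ a, of l] l by (intro essential_bandwidth_fourier_le(2)[OF g bandwidth]) auto
    then show "cmod (xc l * of_real (f l - f k) * fourier g (\<eta> l a))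
        \<le> A l b * \<bar>f l - f k\<bar> * cmod (fourier g (rho \<mu> \<sigma> \<alpha> \<phi> l k b))"
      using l component_props(6)[of l b]
      by (auto simp: norm_mult cmod_xc simp flip: of_real_diff intro!: mult_left_mono)
  qed
  \<comment> \<open>On Z_k the factor |\<mu>/a - \<phi>_k'| is at most \<alpha> / (a \<sigma>(b)),
    which cancels the factor a \<sigma>(b) of the remainder bound. The result no longer depends on
    a.\<close>
  have "\<bar>\<mu> / a - f k\<bar> * cmod (rem g a) \<le> \<alpha> / (a * \<sigma> b) * (a * \<sigma> b * \<Lambda> g k)"
  proof (intro mult_mono remainder_bound_zone g k a_pos)
    have "\<mu> / a - f k = (\<mu> - a * f k) / a"
      using a_pos by (simp add: field_simps)
    then have "\<bar>\<mu> / a - f k\<bar> = \<bar>\<mu> - a * f k\<bar> / a"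
      using a_pos by (simp add: abs_divide)
    also have "\<dots> \<le> \<alpha> / \<sigma> b / a"
      using a a_pos by (intro divide_right_mono) (auto simp: zone_def)
    finally show "\<bar>\<mu> / a - f k\<bar> \<le> \<alpha> / (a * \<sigma> b)" by (simp add: mult.commute)
  qed (use a' a_pos \<alpha>_pos s_pos in auto)
  then have 1: "\<bar>\<mu> / a - f k\<bar> * cmod (rem g a) \<le> \<alpha> * \<Lambda> g k"
    using a_pos by simp
  have "cmod (rem (vderiv g) a) \<le> a * \<sigma> b * \<Lambda> (vderiv g) k"
    using a' by (intro remainder_bound_zone schwartz_vderiv g k a_pos) simp
  then have 2: "cmod (rem (vderiv g) a) / (a * \<sigma> b) \<le> \<Lambda> (vderiv g) k"
    using a_pos s_pos by (simp add: field_simps)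
  have "cmod (Rem1 \<mu> \<sigma> g K A \<phi> k a b)
      \<le> 2 * pi * (\<bar>\<mu> / a - f k\<bar> * cmod (rem g a)) + cmod (rem (vderiv g) a) / (a * \<sigma> b)
        + 2 * pi * cmod (\<Sum>l\<in>{1..K} - {k}. xc l * of_real (f l - f k) * fourier g (\<eta> l a))"
    unfolding Rem1_def using a_pos s_pos
    by (intro order_trans[OF norm_triangle_ineq] order_trans[OF norm_triangle_ineq4] add_mono)
       (auto simp: norm_mult norm_divide simp flip: of_real_diff of_real_divide of_real_mult)
  also have "\<dots> \<le> 2 * pi * (\<alpha> * \<Lambda> g k) + \<Lambda> (vderiv g) k + 2 * pi * S"
    by (intro add_mono mult_left_mono 1 2 S) auto
  also have "\<dots> = 2 * pi * B"
    by (simp add: B_def field_simps)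
  finally have R: "cmod (Rem1 \<mu> \<sigma> g K A \<phi> k a b) \<le> 2 * pi * B" .
  have "S \<ge> 0" by (rule order_trans[OF norm_ge_zero S])
  then have B: "B > 0"
    unfolding B_def using err_bound_pos[OF k W0] err_bound_nonneg[OF k] \<alpha>_pos
    by (intro add_pos_nonneg) auto
  have "\<bar>phase \<mu> \<sigma> g x a b - f k\<bar> = \<bar>Re (phase_c \<mu> \<sigma> g x a b - of_real (f k))\<bar>"
    by (simp add: phase_def)
  also have "\<dots> \<le> cmod (phase_c \<mu> \<sigma> g x a b - of_real (f k))"
    by (rule abs_Re_le_cmod)
  also have "\<dots> = cmod (Rem1 \<mu> \<sigma> g K A \<phi> k a b) / (2 * pi * cmod (W g a))"
    unfolding phase_c_diff[OF a_pos W0 k] by (simp add: norm_divide norm_mult)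
  also have "\<dots> \<le> 2 * pi * B / (2 * pi * cmod (W g a))"
    using R by (intro divide_right_mono) auto
  also have "\<dots> = B / cmod (W g a)" by simp
  also have "\<dots> < B / e1"
    using B e1 W by (intro divide_strict_left_mono mult_pos_pos) auto
  also have "\<dots> = bd \<mu> \<sigma> g \<alpha> \<epsilon>1 \<epsilon>2 K A \<phi> e1 k b"
    by (simp add: bd_def B_def S_def add_divide_distrib)
  finally show ?thesis .
qed

end

subsection \<open>Reassignment and recovery\<close>

lemma compact_support_bounded:
  fixes h :: "real \<Rightarrow> complex"
  assumes "continuous_on UNIV h" and "compact (closure {t. h t \<noteq> 0})"
  obtains R H where "R > 0" "\<And>t. \<bar>t\<bar> > R \<Longrightarrow> h t = 0" "\<And>t. cmod (h t) \<le> H"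
proof -
  let ?C = "closure {t. h t \<noteq> 0}"
  have mem: "t \<in> ?C" if "h t \<noteq> 0" for t
    using that closure_subset[of "{t. h t \<noteq> 0}"] by auto
  obtain R where R: "R > 0" "\<And>t. t \<in> ?C \<Longrightarrow> norm t \<le> R"
    using compact_imp_bounded[OF assms(2)] by (auto simp: bounded_pos)
  have "compact (h ` ?C)"
    using assms continuous_on_subset by (intro compact_continuous_image) blast+
  then obtain H where H: "H > 0" "\<And>t. t \<in> ?C \<Longrightarrow> cmod (h t) \<le> H"
    using compact_imp_bounded by (force simp: bounded_pos)
  show ?thesis
  proof (rule that[OF R(1)])
    show "h t = 0" if "\<bar>t\<bar> > R" for t using R(2)[of t] mem[of t] that by force
    show "cmod (h t) \<le> H" for t
      using H mem[of t] by (cases "h t = 0") auto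
  qed
qed

lemma compact_support_integrable:
  fixes h :: "real \<Rightarrow> complex"
  assumes "continuous_on UNIV h" and "compact (closure {t. h t \<noteq> 0})"
  shows "integrable lborel h"
proof -
  let ?C = "closure {t. h t \<noteq> 0}"
  have "integrable lborel (\<lambda>t. indicator ?C t *\<^sub>R h t)"
    using assms continuous_on_subset by (intro borel_integrable_compact) blast+
  moreover have "indicator ?C t *\<^sub>R h t = h t" for t
    using closure_subset[of "{t. h t \<noteq> 0}"] by (auto simp: indicator_def)
  ultimately show ?thesis by simp
qed

text \<open>The convergence is eventual equality. Once lam R is below the distance d between
  |\<omega> - \<nu>| and e, all points \<omega> + lam t with t in the support of h lie on the same
  side of the window's boundary as \<omega>, so the integral is that of h or 0.\<close>

lemma approximate_identity_window:
  fixes h :: "real \<Rightarrow> complex"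
  assumes h: "continuous_on UNIV h" "compact (closure {t. h t \<noteq> 0})" "(LBINT t. h t) = 1"
    and "\<bar>\<omega> - \<nu>\<bar> \<noteq> e"
  shows "((\<lambda>lam. LBINT t. indicator {\<xi>. \<bar>\<xi> - \<nu>\<bar> < e} (\<omega> + lam * t) *\<^sub>R h t)
    \<longlongrightarrow> (if \<bar>\<omega> - \<nu>\<bar> < e then 1 else 0)) (at_right 0)"
proof (rule tendsto_eventually)
  obtain R where R: "R > 0" "\<And>t. \<bar>t\<bar> > R \<Longrightarrow> h t = 0"
    using compact_support_bounded[OF h(1,2)] by metis
  define d where "d = \<bar>e - \<bar>\<omega> - \<nu>\<bar>\<bar>"
  have d: "d > 0" using assms(4) by (simp add: d_def)
  have "\<forall>\<^sub>F lam in at_right 0. lam < d / R \<and> lam > 0"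
    using d R(1) by (auto simp: eventually_at_right[of 0 1] intro: exI[of _ "d / R"])
  then show "\<forall>\<^sub>F lam in at_right 0. (LBINT t. indicator {\<xi>. \<bar>\<xi> - \<nu>\<bar> < e} (\<omega> + lam * t) *\<^sub>R h t)
      = (if \<bar>\<omega> - \<nu>\<bar> < e then 1 else 0)"
  proof eventually_elim
    case (elim lam)
    have near: "\<bar>lam * t\<bar> < d" if "\<bar>t\<bar> \<le> R" for t
    proof -
      have "\<bar>lam * t\<bar> \<le> lam * R" using that elim by (simp add: abs_mult mult_left_mono)
      also have "\<dots> < d" using elim R(1) by (simp add: field_simps)
      finally show ?thesis .
    qed
    have eq: "indicator {\<xi>. \<bar>\<xi> - \<nu>\<bar> < e} (\<omega> + lam * t) *\<^sub>R h t = (if \<bar>\<omega> - \<nu>\<bar> < e then h t else 0)" for t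
    proof (cases "\<bar>t\<bar> \<le> R")
      case True
      from near[OF this] have "\<bar>\<omega> + lam * t - \<nu>\<bar> < e \<longleftrightarrow> \<bar>\<omega> - \<nu>\<bar> < e"
        unfolding d_def by linarith
      then show ?thesis by (auto simp: indicator_def)
    qed (use R(2)[of t] in auto)
    show ?case unfolding eq using h(3) by simp
  qed
qed

text \<open>Integrating over \<xi> before a reduces the kernel to the weight G, which is bounded by
  the L1 norm of h uniformly in lam and tends to 0 or 1 for each a in S. Since V is bounded on S,
  which has finite measure, dominated convergence applies in a.\<close>

lemma reassignment_limit:
  fixes h V :: "real \<Rightarrow> complex" and \<omega> :: "real \<Rightarrow> real"
  assumes h: "continuous_on UNIV h" "compact (closure {t. h t \<noteq> 0})" "(LBINT t. h t) = 1"
    and S [measurable]: "S \<in> sets borel" and S_bounded: "S \<subseteq> {p..q}"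
    and meas [measurable]: "V \<in> borel_measurable borel" "\<omega> \<in> borel_measurable borel"
    and V_bound: "\<And>a. a \<in> S \<Longrightarrow> cmod (V a) \<le> B"
    and ne: "\<And>a. a \<in> S \<Longrightarrow> \<bar>\<omega> a - \<nu>\<bar> \<noteq> e"
  shows "((\<lambda>lam. LBINT \<xi>:{\<xi>. \<bar>\<xi> - \<nu>\<bar> < e}. LBINT a:S. V a * of_real (1 / lam) * h ((\<xi> - \<omega> a) / lam))
    \<longlongrightarrow> (LBINT a:{a\<in>S. \<bar>\<omega> a - \<nu>\<bar> < e}. V a)) (at_right 0)"
proof -
  obtain H where H: "\<And>t. cmod (h t) \<le> H" using compact_support_bounded[OF h(1,2)] by metis
  have H0: "H \<ge> 0" using H[of 0] norm_ge_zero order_trans by blast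
  have [measurable]: "h \<in> borel_measurable borel"
    by (rule borel_measurable_continuous_onI[OF h(1)])
  note h_int = compact_support_integrable[OF h(1,2)]
  define I where "I = {\<xi>::real. \<bar>\<xi> - \<nu>\<bar> < e}"
  have I_eq: "I = {\<nu> - e<..<\<nu> + e}" by (auto simp: I_def)
  have [measurable]: "I \<in> sets borel" by (simp add: I_eq)
  have S_finite: "emeasure lborel S < \<infinity>"
    using emeasure_mono[OF S_bounded, of lborel] by (simp add: order.strict_trans1 emeasure_lborel_Icc_eq)
  have S_int: "integrable lborel (\<lambda>a. B' * indicator S a)" for B' :: real
    using S_finite by (intro integrable_mult_right integrable_real_indicator) auto
  define G where "G = (\<lambda>lam a. LBINT t. indicator I (\<omega> a + lam * t) *\<^sub>R h t)"
  have swap: "(LBINT \<xi>:I. LBINT a:S. V a * of_real (1 / lam) * h ((\<xi> - \<omega> a) / lam))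
      = (LBINT a. indicator S a *\<^sub>R (V a * G lam a))" if lam: "lam > 0" for lam
  proof -
    define F where "F = (\<lambda>\<xi> a. indicator I \<xi> *\<^sub>R (indicator S a *\<^sub>R (V a * of_real (1 / lam) * h ((\<xi> - \<omega> a) / lam))))"
    \<comment> \<open>For fixed lam the integrand is bounded and vanishes off I \<times> S, a set of
      finite measure; this justifies exchanging the integrals.\<close>
    have F_int: "integrable (lborel \<Otimes>\<^sub>M lborel) (case_prod F)"
    proof (rule integrableI_bounded_set[where A = "I \<times> S" and B = "B * (1 / lam) * H"])
      show "case_prod F \<in> borel_measurable (lborel \<Otimes>\<^sub>M lborel)"
        unfolding F_def by measurable
      have "emeasure (lborel \<Otimes>\<^sub>M lborel) (I \<times> S) = emeasure lborel I * emeasure lborel S"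
        by (rule lborel.emeasure_pair_measure_Times) auto
      also have "\<dots> < \<infinity>"
        using S_finite emeasure_bounded_finite[of I] by (simp add: I_eq ennreal_mult_less_top)
      finally show "emeasure (lborel \<Otimes>\<^sub>M lborel) (I \<times> S) < \<infinity>" .
      show "AE z in lborel \<Otimes>\<^sub>M lborel. z \<in> I \<times> S \<longrightarrow> norm (case_prod F z) \<le> B * (1 / lam) * H"
      proof (intro AE_I2 impI, clarsimp)
        fix \<xi> a assume "\<xi> \<in> I" "a \<in> S"
        then have "cmod (F \<xi> a) = cmod (V a) * (1 / lam) * cmod (h ((\<xi> - \<omega> a) / lam))"
          using lam by (simp add: F_def norm_mult norm_divide)
        also have "\<dots> \<le> B * (1 / lam) * H"
          using V_bound[OF \<open>a \<in> S\<close>] H lam order_trans[OF norm_ge_zero V_bound[OF \<open>a \<in> S\<close>]]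
          by (intro mult_mono) auto
        finally show "cmod (F \<xi> a) \<le> B * H / lam" by simp
      qed
      show "AE z in lborel \<Otimes>\<^sub>M lborel. z \<notin> I \<times> S \<longrightarrow> case_prod F z = 0"
        by (intro AE_I2) (auto simp: F_def indicator_def)
    qed auto
    \<comment> \<open>The substitution \<xi> = \<omega>(a) + lam t cancels the factor 1 / lam and
      recentres the kernel at the phase value.\<close>
    have inner: "(LBINT \<xi>. F \<xi> a) = indicator S a *\<^sub>R (V a * G lam a)" for a
    proof -
      have "(LBINT \<xi>. F \<xi> a)
          = lam *\<^sub>R (LBINT t. F (\<omega> a + lam * t) a)"
        using lam by (subst lborel_integral_real_affine[where c = lam and t = "\<omega> a"]) auto
      also have "\<dots> = (LBINT t. lam *\<^sub>R F (\<omega> a + lam * t) a)"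
        by (rule integral_scaleR_right[symmetric])
      also have "\<dots> = (LBINT t. (indicator S a *\<^sub>R V a) * (indicator I (\<omega> a + lam * t) *\<^sub>R h t))"
        using lam by (intro Bochner_Integration.integral_cong refl) (simp add: F_def scaleR_conv_of_real)
      also have "\<dots> = (indicator S a *\<^sub>R V a) * G lam a"
        unfolding G_def by (rule integral_mult_right_zero)
      finally show ?thesis by simp
    qed
    have "(LBINT \<xi>:I. LBINT a:S. V a * of_real (1 / lam) * h ((\<xi> - \<omega> a) / lam)) = (LBINT \<xi>. LBINT a. F \<xi> a)"
      unfolding set_lebesgue_integral_def F_def by (simp only: integral_scaleR_right)
    also have "\<dots> = (LBINT a. LBINT \<xi>. F \<xi> a)"
      by (rule lborel_pair.Fubini_integral[OF F_int, symmetric])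
    finally show ?thesis by (simp add: inner)
  qed
  have G_bound: "cmod (G lam a) \<le> (LBINT t. cmod (h t))" for lam a
  proof -
    have "(\<lambda>t. indicator I (\<omega> a + lam * t) *\<^sub>R h t) \<in> borel_measurable lborel" by measurable
    then have "integrable lborel (\<lambda>t. indicator I (\<omega> a + lam * t) *\<^sub>R h t)"
      by (rule Bochner_Integration.integrable_bound[OF h_int]) (auto simp: indicator_def)
    then show ?thesis
      unfolding G_def using h_int
      by (intro Bochner_Integration.integral_norm_bound_integral) (auto simp: indicator_def)
  qed
  have [measurable]: "G lam \<in> borel_measurable borel" for lam
    unfolding G_def by measurable
  have lim: "((\<lambda>lam. LBINT a. indicator S a *\<^sub>R (V a * G lam a))
      \<longlongrightarrow> (LBINT a. indicator S a *\<^sub>R (V a * (if \<bar>\<omega> a - \<nu>\<bar> < e then 1 else 0)))) (at_right 0)"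
    unfolding tendsto_at_iff_sequentially comp_def
  proof (intro allI impI)
    fix X :: "nat \<Rightarrow> real" assume X: "\<forall>i. X i \<in> {0<..} - {0}" "X \<longlonglongrightarrow> 0"
    show "(\<lambda>i. LBINT a. indicator S a *\<^sub>R (V a * G (X i) a))
      \<longlonglongrightarrow> (LBINT a. indicator S a *\<^sub>R (V a * (if \<bar>\<omega> a - \<nu>\<bar> < e then 1 else 0)))"
    proof (rule integral_dominated_convergence[where w = "\<lambda>a. (B * (LBINT t. cmod (h t))) * indicator S a"])
      show "AE a in lborel. (\<lambda>i. indicator S a *\<^sub>R (V a * G (X i) a))
          \<longlonglongrightarrow> indicator S a *\<^sub>R (V a * (if \<bar>\<omega> a - \<nu>\<bar> < e then 1 else 0))"
      proof (intro AE_I2)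
        fix a
        show "(\<lambda>i. indicator S a *\<^sub>R (V a * G (X i) a))
          \<longlonglongrightarrow> indicator S a *\<^sub>R (V a * (if \<bar>\<omega> a - \<nu>\<bar> < e then 1 else 0))"
        proof (cases "a \<in> S")
          case True
          have "(\<lambda>i. G (X i) a) \<longlonglongrightarrow> (if \<bar>\<omega> a - \<nu>\<bar> < e then 1 else 0)"
            using approximate_identity_window[OF h ne[OF True]] X
            unfolding G_def I_def tendsto_at_iff_sequentially comp_def by blast
          then show ?thesis by (intro tendsto_intros)
        qed simp
      qed
      show "AE a in lborel. norm (indicator S a *\<^sub>R (V a * G (X i) a)) \<le> (B * (LBINT t. cmod (h t))) * indicator S a" for i
        using V_bound G_bound order_trans[OF norm_ge_zero V_bound]
        by (intro AE_I2) (auto simp: indicator_def norm_mult intro!: mult_mono)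
      show "integrable lborel (\<lambda>a. (B * (LBINT t. cmod (h t))) * indicator S a)"
        by (rule S_int)
    qed measurable
  qed
  have restrict: "(LBINT a. indicator S a *\<^sub>R (V a * (if \<bar>\<omega> a - \<nu>\<bar> < e then 1 else 0)))
      = (LBINT a:{a\<in>S. \<bar>\<omega> a - \<nu>\<bar> < e}. V a)"
    unfolding set_lebesgue_integral_def
    by (intro Bochner_Integration.integral_cong) (auto simp: indicator_def)
  have "\<forall>\<^sub>F lam in at_right 0. (LBINT a. indicator S a *\<^sub>R (V a * G lam a))
      = (LBINT \<xi>:I. LBINT a:S. V a * of_real (1 / lam) * h ((\<xi> - \<omega> a) / lam))"
    using eventually_at_right_less[of "0::real"] by eventually_elim (rule swap[symmetric])
  from Lim_transform_eventually[OF lim this] show ?thesis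
    unfolding restrict I_def .
qed

text \<open>The measure d\<xi>/\<xi> is invariant under dilation. With r = \<phi>_k'(b), the
  frequency interval in \<open>c_psi\<close> and \<open>cross_coeff\<close> becomes the k-th zone of
  scales, so both can be compared with integrals of W da/a.\<close>

lemma set_integral_scale:
  fixes u :: "real \<Rightarrow> complex"
  assumes "r > 0"
  shows "(LBINT \<xi>:{p..q}. u \<xi> / of_real \<xi>) = (LBINT a:{p / r..q / r}. u (r * a) / of_real a)"
proof -
  have "(LBINT \<xi>:{p..q}. u \<xi> / of_real \<xi>)
      = r *\<^sub>R (LBINT a. indicator {p..q} (r * a) *\<^sub>R (u (r * a) / of_real (r * a)))"
    unfolding set_lebesgue_integral_def using assms
    by (subst lborel_integral_real_affine[where c = r and t = 0]) auto
  also have "\<dots> = (LBINT a. indicator {p / r..q / r} a *\<^sub>R (u (r * a) / of_real a))"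
  proof (subst integral_scaleR_right[symmetric], intro Bochner_Integration.integral_cong refl)
    fix a
    have "r * a \<in> {p..q} \<longleftrightarrow> a \<in> {p / r..q / r}"
      using assms by (auto simp: field_simps)
    then show "r *\<^sub>R (indicator {p..q} (r * a) *\<^sub>R (u (r * a) / of_real (r * a)))
        = indicator {p / r..q / r} a *\<^sub>R (u (r * a) / complex_of_real a)"
      using assms by (simp add: indicator_def scaleR_conv_of_real)
  qed
  finally show ?thesis by (simp add: set_lebesgue_integral_def)
qed

context wsst
begin

text \<open>The gap only looks at the two neighbours of k; monotonicity of the frequencies makes it
  a lower bound for the distance to every other component.\<close>

lemma freq_gap_le:
  assumes k: "k \<in> {1..K}" and l: "l \<in> {1..K}" "l \<noteq> k" and e: "ereal e \<le> freq_gap K \<phi> k b / 2"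
  shows "2 * e \<le> \<bar>f l - f k\<bar>"
proof -
  have half: "2 * e \<le> d" if "freq_gap K \<phi> k b \<le> ereal d" for d
  proof -
    have "freq_gap K \<phi> k b / 2 \<le> ereal d / 2"
      using that by (intro ereal_divide_right_mono) auto
    with e have "ereal e \<le> ereal d / 2" by (rule order_trans)
    then show ?thesis by simp
  qed
  show ?thesis
  proof (cases "l < k")
    case True
    then have "freq_gap K \<phi> k b \<le> ereal (f k - f (k - 1))"
      using l by (auto simp: freq_gap_def min.coboundedI1)
    moreover have "f l \<le> f (k - 1)" "f (k - 1) < f k"
      using True l k by (auto intro!: f_mono f_less)
    ultimately show ?thesis using half[of "f k - f (k - 1)"] by linarith
  next
    case False
    then have "k < l" using l by simp
    then have "freq_gap K \<phi> k b \<le> ereal (f (k + 1) - f k)"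
      using l by (auto simp: freq_gap_def min.coboundedI2)
    moreover have "f (k + 1) \<le> f l" "f k < f (k + 1)"
      using \<open>k < l\<close> l k by (auto intro!: f_mono f_less)
    ultimately show ?thesis using half[of "f (k + 1) - f k"] by linarith
  qed
qed

section \<open>The integral over one zone and its error terms\<close>

abbreviation J where "J k \<equiv> {zmin k..zmax k}"
abbreviation S where "S e1 \<equiv> {a \<in> {amin..amax}. cmod (W g a) > e1}"

lemma cross_coeff_eq:
  assumes "k \<in> {1..K}"
  shows "cross_coeff \<mu> \<sigma> g \<alpha> \<phi> l k b = (LBINT a:J k. fourier g (\<eta> l a) / of_real a)"
    and "c_psi \<mu> \<sigma> g \<alpha> b = (LBINT a:J k. fourier g (\<eta> k a) / of_real a)"
  using f_pos[OF assms] unfolding cross_coeff_def c_psi_def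
  by (subst set_integral_scale[where r = "f k"]; simp add: mult.commute)+

text \<open>These two quantities produce the constants of \<open>recovery_bd\<close>: the integral
  of da/a over the zone is the logarithm of the first, and the second multiplies \<Lambda>_k when
  the remainder is integrated.\<close>

lemma zone_ratio:
  assumes "k \<in> {1..K}"
  shows "zmax k / zmin k = (\<mu> * \<sigma> b + \<alpha>) / (\<mu> * \<sigma> b - \<alpha>)"
    and "\<sigma> b * (zmax k - zmin k) = 2 * \<alpha> / f k"
proof -
  have "zmax k / zmin k = (\<mu> + \<alpha> / \<sigma> b) / (\<mu> - \<alpha> / \<sigma> b)"
    using f_pos[OF assms] by simp
  also have "\<dots> = ((\<mu> + \<alpha> / \<sigma> b) * \<sigma> b) / ((\<mu> - \<alpha> / \<sigma> b) * \<sigma> b)"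
    by simp
  finally show "zmax k / zmin k = (\<mu> * \<sigma> b + \<alpha>) / (\<mu> * \<sigma> b - \<alpha>)"
    by (simp add: distrib_right left_diff_distrib)
  have "\<sigma> b * (zmax k - zmin k) = (\<sigma> b * (\<mu> + \<alpha> / \<sigma> b) - \<sigma> b * (\<mu> - \<alpha> / \<sigma> b)) / f k"
    by (simp add: diff_divide_distrib right_diff_distrib)
  then show "\<sigma> b * (zmax k - zmin k) = 2 * \<alpha> / f k"
    by (simp add: distrib_left right_diff_distrib)
qed

lemma integral_inverse_zone:
  assumes "k \<in> {1..K}"
  shows "has_bochner_integral lborel (\<lambda>a. 1 / a * indicator (J k) a) (ln ((\<mu> * \<sigma> b + \<alpha>) / (\<mu> * \<sigma> b - \<alpha>)))"
proof -
  have pos: "zmin k > 0" "zmin k < zmax k" using zone_subset_scales[OF assms] by auto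
  have "has_bochner_integral lborel (\<lambda>a. 1 / a * indicator (J k) a) (ln (zmax k) - ln (zmin k))"
  proof (rule has_bochner_integral_FTC_Icc_real)
    fix a assume "zmin k \<le> a" "a \<le> zmax k"
    then have "a > 0" using pos by linarith
    then show "DERIV ln a :> 1 / a" "isCont (\<lambda>a. 1 / a) a"
      by (auto intro!: derivative_eq_intros continuous_intros)
  qed (use pos in simp)
  moreover have "ln (zmax k) - ln (zmin k) = ln (zmax k / zmin k)"
    using pos by (subst ln_div) auto
  ultimately show ?thesis by (simp only: zone_ratio[OF assms])
qed

lemma set_integrable_zone:
  assumes "k \<in> {1..K}" and "continuous_on UNIV u"
  shows "integrable lborel (\<lambda>a. indicator (J k) a *\<^sub>R (u a / complex_of_real a))"
proof (rule borel_integrable_compact)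
  have "\<forall>a\<in>J k. complex_of_real a \<noteq> 0"
    using zone_subset_scales(4)[OF assms(1)] by (metis atLeastAtMost_iff not_le of_real_eq_0_iff)
  then show "continuous_on (J k) (\<lambda>a. u a / complex_of_real a)"
    by (intro continuous_intros continuous_on_subset[OF assms(2)]) auto
qed simp

text \<open>The integral over the whole zone differs from c_psi x_k(b) by the remainder R and the
  cross terms; restricting it to scales above the threshold loses L. On L, |W| \<le> e1 gives e1
  times the integral of da/a. On R, |rem| / a \<le> \<sigma>(b) \<Lambda>_k gives a constant times
  the length of the zone.\<close>

lemma zone_integral_error:
  assumes k: "k \<in> {1..K}" and e1: "e1 > 0"
  shows "cmod ((LBINT a:S e1 \<inter> J k. W g a / of_real a) - c_psi \<mu> \<sigma> g \<alpha> b * xc k)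
    \<le> e1 * ln ((\<mu> * \<sigma> b + \<alpha>) / (\<mu> * \<sigma> b - \<alpha>)) + 2 * \<alpha> / f k * \<Lambda> g k
      + (\<Sum>l\<in>{1..K} - {k}. A l b * cmod (cross_coeff \<mu> \<sigma> g \<alpha> \<phi> l k b))"
proof -
  have pos: "a > 0" if "a \<in> J k" for a
    using that zone_subset_scales(4)[OF k] by simp
  have contW: "continuous_on UNIV (W g)" by (rule W_continuous[OF g])
  have [measurable]: "W g \<in> borel_measurable borel"
    by (rule borel_measurable_continuous_onI[OF contW])
  have contF: "continuous_on UNIV (\<lambda>a. fourier g (\<eta> l a))" for l
    by (rule continuous_on_compose2[OF fourier_continuous[OF schwartz_integrable[OF g]]])
       (auto intro!: continuous_intros)
  define q where "q = (\<lambda>l a. indicator (J k) a *\<^sub>R (fourier g (\<eta> l a) / complex_of_real a))"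
  define c where "c = (\<lambda>l. LBINT a. q l a)"
  have q_int: "integrable lborel (q l)" for l
    unfolding q_def by (rule set_integrable_zone[OF k contF])
  have c: "cross_coeff \<mu> \<sigma> g \<alpha> \<phi> l k b = c l" "c_psi \<mu> \<sigma> g \<alpha> b = c k" for l
    using cross_coeff_eq[OF k] by (auto simp: c_def q_def set_lebesgue_integral_def)
  define V where "V = (\<lambda>a. indicator (J k) a *\<^sub>R (W g a / complex_of_real a))"
  define R where "R = (\<lambda>a. indicator (J k) a *\<^sub>R (rem g a / complex_of_real a))"
  define L where "L = (\<lambda>a. indicator (- S e1) a *\<^sub>R V a)"
  have V_int: "integrable lborel V"
    unfolding V_def by (rule set_integrable_zone[OF k contW])
  have "continuous_on UNIV (rem g)"
    unfolding remainder_def by (intro continuous_intros contW contF)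
  then have R_int: "integrable lborel R"
    unfolding R_def by (rule set_integrable_zone[OF k])
  have L_int: "integrable lborel L"
    unfolding L_def by (rule integrable_mult_indicator[OF _ V_int]) measurable
  have "(LBINT a. V a) = (LBINT a. R a + (\<Sum>l=1..K. xc l * q l a))"
    by (intro Bochner_Integration.integral_cong refl)
       (auto simp: V_def R_def q_def remainder_def indicator_def diff_divide_distrib sum_divide_distrib)
  also have "\<dots> = (LBINT a. R a) + (\<Sum>l=1..K. xc l * c l)"
    unfolding c_def using q_int R_int
    by (subst Bochner_Integration.integral_add) (auto simp: Bochner_Integration.integral_sum)
  also have "(\<Sum>l=1..K. xc l * c l) = xc k * c k + (\<Sum>l\<in>{1..K} - {k}. xc l * c l)"
    using k by (intro sum.remove) auto
  finally have V_eq: "(LBINT a. V a) = (LBINT a. R a) + (xc k * c k + (\<Sum>l\<in>{1..K} - {k}. xc l * c l))" .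
  have "(LBINT a:S e1 \<inter> J k. W g a / of_real a) = (LBINT a. V a - L a)"
    unfolding set_lebesgue_integral_def
    by (intro Bochner_Integration.integral_cong refl) (auto simp: V_def L_def indicator_def)
  also have "\<dots> = (LBINT a. V a) - (LBINT a. L a)"
    using V_int L_int by simp
  finally have "(LBINT a:S e1 \<inter> J k. W g a / of_real a) - c k * xc k
      = - (LBINT a. L a) + (LBINT a. R a) + (\<Sum>l\<in>{1..K} - {k}. xc l * c l)"
    by (simp add: V_eq)
  also have "cmod \<dots> \<le> cmod (LBINT a. L a) + cmod (LBINT a. R a) + cmod (\<Sum>l\<in>{1..K} - {k}. xc l * c l)"
    using norm_triangle_ineq[of "- (LBINT a. L a) + (LBINT a. R a)" "\<Sum>l\<in>{1..K} - {k}. xc l * c l"]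
      norm_triangle_ineq[of "- (LBINT a. L a)" "LBINT a. R a"] by simp
  also have "\<dots> \<le> e1 * ln ((\<mu> * \<sigma> b + \<alpha>) / (\<mu> * \<sigma> b - \<alpha>)) + 2 * \<alpha> / f k * \<Lambda> g k
      + (\<Sum>l\<in>{1..K} - {k}. A l b * cmod (c l))"
  proof (intro add_mono)
    note inv = integral_inverse_zone[OF k]
    have "cmod (LBINT a. L a) \<le> (LBINT a. e1 * (1 / a * indicator (J k) a))"
    proof (rule Bochner_Integration.integral_norm_bound_integral[OF L_int])
      show "integrable lborel (\<lambda>a. e1 * (1 / a * indicator (J k) a))"
        using inv by (intro integrable_mult_right) (auto simp: has_bochner_integral_iff)
      fix a
      show "norm (L a) \<le> e1 * (1 / a * indicator (J k) a)"
      proof (cases "a \<in> J k \<and> a \<notin> S e1")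
        case True
        \<comment> \<open>The zone lies inside the range of scales, so a scale in \<open>J k\<close>
          outside \<open>S e1\<close> must fail the threshold test.\<close>
        then have "cmod (W g a) \<le> e1" "a > 0"
          using zone_subset_scales(1,2)[OF k] pos by auto
        then show ?thesis
          using True by (simp add: L_def V_def norm_divide divide_right_mono)
      next
        case False
        then show ?thesis
          using pos[of a] e1 by (auto simp: L_def V_def indicator_def)
      qed
    qed
    also have "\<dots> = e1 * ln ((\<mu> * \<sigma> b + \<alpha>) / (\<mu> * \<sigma> b - \<alpha>))"
      by (subst integral_mult_right_zero) (simp only: has_bochner_integral_integral_eq[OF inv])
    finally show "cmod (LBINT a. L a) \<le> \<dots>" .
    have len: "(LBINT a. \<sigma> b * \<Lambda> g k * indicator (J k) a) = \<sigma> b * \<Lambda> g k * (zmax k - zmin k)"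
      using zone_subset_scales(3)[OF k] by simp
    have "cmod (LBINT a. R a) \<le> (LBINT a. \<sigma> b * \<Lambda> g k * indicator (J k) a)"
    proof (rule Bochner_Integration.integral_norm_bound_integral[OF R_int])
      show "integrable lborel (\<lambda>a. \<sigma> b * \<Lambda> g k * indicator (J k) a)"
        by (intro integrable_mult_right integrable_real_indicator) (auto simp: emeasure_lborel_Icc_eq)
      fix a
      show "norm (R a) \<le> \<sigma> b * \<Lambda> g k * indicator (J k) a"
      proof (cases "a \<in> J k")
        case True
        then have "cmod (rem g a) / a \<le> a * \<sigma> b * \<Lambda> g k / a"
          using pos[OF True] by (intro divide_right_mono remainder_bound_zone g k) auto
        then show ?thesis
          using True pos[OF True] by (simp add: R_def norm_divide)
      qed (simp add: R_def)
    qed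
    also have "\<dots> = (\<sigma> b * (zmax k - zmin k)) * \<Lambda> g k"
      unfolding len by (simp add: mult_ac)
    also have "\<dots> = 2 * \<alpha> / f k * \<Lambda> g k"
      by (simp only: zone_ratio(2)[OF k])
    finally show "cmod (LBINT a. R a) \<le> 2 * \<alpha> / f k * \<Lambda> g k" .
    show "cmod (\<Sum>l\<in>{1..K} - {k}. xc l * c l) \<le> (\<Sum>l\<in>{1..K} - {k}. A l b * cmod (c l))"
      by (intro sum_norm_le) (auto simp: norm_mult cmod_xc)
  qed
  finally show ?thesis by (simp only: c)
qed

lemma recovery:
  assumes h: "continuous_on UNIV h" "compact (closure {t. h t \<noteq> 0})" "(LBINT t. h t) = 1"
    and k: "k \<in> {1..K}" and e1: "e1 > 0" and c: "c_psi \<mu> \<sigma> g \<alpha> b \<noteq> 0"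
    and thr: "threshold_cond \<mu> \<sigma> g \<alpha> \<tau>0 \<epsilon>1 \<epsilon>2 K A \<phi> e1 b"
    and bd: "\<And>l. l \<in> {1..K} \<Longrightarrow> bd \<mu> \<sigma> g \<alpha> \<epsilon>1 \<epsilon>2 K A \<phi> e1 l b \<le> e3"
    and gap: "ereal e3 \<le> freq_gap K \<phi> k b / 2"
  shows "\<exists>R. ((\<lambda>lam. 1 / c_psi \<mu> \<sigma> g \<alpha> b *
      (LBINT \<xi>:{\<xi>. \<bar>\<xi> - f k\<bar> < e3}. awsst \<mu> \<sigma> g \<alpha> K A \<phi> h e1 lam \<xi> b)) \<longlongrightarrow> R) (at_right 0)
    \<and> cmod (R - xc k) \<le> recovery_bd \<mu> \<sigma> g \<alpha> \<epsilon>1 \<epsilon>2 K A \<phi> e1 k b"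
proof -
  have W_meas: "W w \<in> borel_measurable borel" if "schwartz w" for w
    by (rule borel_measurable_continuous_onI[OF W_continuous[OF that]])
  have [measurable]: "W g \<in> borel_measurable borel" "W (vderiv g) \<in> borel_measurable borel"
    by (intro W_meas g schwartz_vderiv)+
  \<comment> \<open>The closed form of the phase is used as a function of every real a: it is
    visibly measurable and agrees with \<open>phase\<close> on \<open>S e1\<close>, where W does not
    vanish.\<close>
  define \<omega> where "\<omega> = (\<lambda>a. Re (of_real (\<mu> / a) - W (vderiv g) a / (\<i> * of_real (2 * pi) * of_real (a * \<sigma> b) * W g a)))"
  define V where "V = (\<lambda>a. W g a / complex_of_real a)"
  have S_pos: "a > 0" if "a \<in> S e1" for a using that amin_pos by auto
  have phase_eq: "phase \<mu> \<sigma> g x a b = \<omega> a" if "a \<in> S e1" for a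
  proof -
    have "W g a \<noteq> 0" using that e1 by auto
    from phase_c_eq[OF S_pos[OF that] this] show ?thesis
      by (simp only: phase_def \<omega>_def)
  qed
  have S_meas: "S e1 \<in> sets borel" by measurable
  have "compact (W g ` {amin..amax})"
    using W_continuous[OF g] by (intro compact_continuous_image) (auto intro: continuous_on_subset)
  then obtain B where B: "\<And>a. a \<in> {amin..amax} \<Longrightarrow> cmod (W g a) \<le> B"
    using compact_imp_bounded by (force simp: bounded_iff)
  \<comment> \<open>If a lies in the zone of some l \<noteq> k, then \<omega>(a) is strictly within
    e3 of \<phi>_l', and \<phi>_l' is at least 2 e3 away from \<phi>_k', so |\<omega>(a) -
    \<phi>_k'| > e3. Strictness on both sides excludes the boundary value e3.\<close>
  have dichotomy: "\<bar>\<omega> a - f k\<bar> \<noteq> e3 \<and> (\<bar>\<omega> a - f k\<bar> < e3 \<longleftrightarrow> a \<in> {zmin k<..<zmax k})" if a: "a \<in> S e1" for a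
  proof -
    obtain l where l: "l \<in> {1..K}" "(a, b) \<in> zone \<mu> \<sigma> \<alpha> \<phi> l"
      using zone_exists_unique[OF thr, of a] a by auto
    have "\<bar>phase \<mu> \<sigma> g x a b - f l\<bar> < bd \<mu> \<sigma> g \<alpha> \<epsilon>1 \<epsilon>2 K A \<phi> e1 l b"
      by (rule phase_error[OF l(1) e1 l(2)]) (use a in simp)
    with bd[OF l(1)] have near: "\<bar>\<omega> a - f l\<bar> < e3"
      unfolding phase_eq[OF a] by linarith
    show ?thesis
    proof (cases "l = k")
      case True
      with near l zone_iff[OF k] show ?thesis by simp
    next
      case False
      then have "2 * e3 \<le> \<bar>f l - f k\<bar>" by (rule freq_gap_le[OF k l(1) _ gap])
      with near have "\<bar>\<omega> a - f k\<bar> > e3" by linarith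
      moreover have "a \<notin> {zmin k<..<zmax k}"
        using zone_unique[OF k l(1) _ l(2)] zone_iff[OF k] False by blast
      ultimately show ?thesis by auto
    qed
  qed
  have "((\<lambda>lam. LBINT \<xi>:{\<xi>. \<bar>\<xi> - f k\<bar> < e3}. LBINT a:S e1. V a * of_real (1 / lam) * h ((\<xi> - \<omega> a) / lam))
      \<longlongrightarrow> (LBINT a:{a \<in> S e1. \<bar>\<omega> a - f k\<bar> < e3}. V a)) (at_right 0)"
  proof (rule reassignment_limit[OF h S_meas])
    show "S e1 \<subseteq> {amin..amax}" by auto
    show "V \<in> borel_measurable borel" "\<omega> \<in> borel_measurable borel"
      unfolding V_def \<omega>_def by measurable
    \<comment> \<open>The positive lower end of the scale range keeps 1 / a bounded.\<close>
    show "cmod (V a) \<le> B / amin" if "a \<in> S e1" for a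
      using that B[of a] amin_pos e1 by (auto simp: V_def norm_divide intro!: frac_le)
    show "\<bar>\<omega> a - f k\<bar> \<noteq> e3" if "a \<in> S e1" for a
      using dichotomy[OF that] by blast
  qed
  also have "(\<lambda>lam. LBINT \<xi>:{\<xi>. \<bar>\<xi> - f k\<bar> < e3}. LBINT a:S e1. V a * of_real (1 / lam) * h ((\<xi> - \<omega> a) / lam))
      = (\<lambda>lam. LBINT \<xi>:{\<xi>. \<bar>\<xi> - f k\<bar> < e3}. awsst \<mu> \<sigma> g \<alpha> K A \<phi> h e1 lam \<xi> b)"
  proof -
    have "(LBINT a:S e1. V a * of_real (1 / lam) * h ((\<xi> - \<omega> a) / lam)) = awsst \<mu> \<sigma> g \<alpha> K A \<phi> h e1 lam \<xi> b" for lam \<xi>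
      unfolding awsst_def Let_def
      by (rule set_lebesgue_integral_cong) (use S_meas phase_eq in \<open>auto simp: V_def\<close>)
    then show ?thesis by simp
  qed
  also have "(LBINT a:{a \<in> S e1. \<bar>\<omega> a - f k\<bar> < e3}. V a) = (LBINT a:S e1 \<inter> J k. V a)"
  proof -
    \<comment> \<open>The dichotomy yields the open zone, whereas \<open>J k\<close> is closed; the
      two endpoints form a null set.\<close>
    have "AE a in lborel. a \<noteq> zmin k" "AE a in lborel. a \<noteq> zmax k"
      by (rule AE_lborel_singleton)+
    then have ae: "AE a in lborel. a \<in> {a \<in> S e1. \<bar>\<omega> a - f k\<bar> < e3} \<longleftrightarrow> a \<in> S e1 \<inter> J k"
      by eventually_elim (use dichotomy in auto)
    have [measurable]: "\<omega> \<in> borel_measurable borel" "V \<in> borel_measurable borel"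
      unfolding \<omega>_def V_def by measurable
    have "AE a in lborel. indicator {a \<in> S e1. \<bar>\<omega> a - f k\<bar> < e3} a *\<^sub>R V a = indicator (S e1 \<inter> J k) a *\<^sub>R V a"
      using ae by eventually_elim (auto simp: indicator_def)
    then show ?thesis
      unfolding set_lebesgue_integral_def by (intro integral_cong_AE) measurable
  qed
  finally have lim: "((\<lambda>lam. LBINT \<xi>:{\<xi>. \<bar>\<xi> - f k\<bar> < e3}. awsst \<mu> \<sigma> g \<alpha> K A \<phi> h e1 lam \<xi> b)
      \<longlongrightarrow> (LBINT a:S e1 \<inter> J k. V a)) (at_right 0)" .
  let ?c = "c_psi \<mu> \<sigma> g \<alpha> b" and ?I = "LBINT a:S e1 \<inter> J k. V a"
  have "1 / ?c * ?I - xc k = (?I - ?c * xc k) / ?c"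
    using c by (simp add: diff_divide_distrib)
  then have "cmod (1 / ?c * ?I - xc k) = cmod (?I - ?c * xc k) / cmod ?c"
    by (simp add: norm_divide)
  also have "\<dots> \<le> recovery_bd \<mu> \<sigma> g \<alpha> \<epsilon>1 \<epsilon>2 K A \<phi> e1 k b"
    using divide_right_mono[OF zone_integral_error[OF k e1] norm_ge_zero[of ?c]]
    by (simp add: recovery_bd_def V_def)
  finally show ?thesis
    using tendsto_mult[OF tendsto_const[of "1 / ?c"] lim] by blast
qed

end

theorem theorem1:
  fixes g h :: "real \<Rightarrow> complex" and \<sigma> :: "real \<Rightarrow> real"
    and A \<phi> :: "nat \<Rightarrow> real \<Rightarrow> real" and K :: nat
    and \<mu> \<alpha> \<tau>0 \<epsilon>1 \<epsilon>2 b e1 :: real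
  assumes "\<mu> > 0"
    and "schwartz g"
    and "\<forall>t. \<sigma> t > 0" and "\<forall>t. \<sigma> differentiable (at t)"
    and "essential_bandwidth g \<alpha> \<tau>0"
    and "continuous_on UNIV h" and "compact (closure {t. h t \<noteq> 0})" and "(LBINT t. h t) = 1"
    and "\<epsilon>1 > 0" and "\<epsilon>2 > 0"
    and "signal_class \<epsilon>1 \<epsilon>2 K A \<phi>"
    and "\<forall>t. \<sigma> t > \<alpha> / \<mu>"
    and "\<forall>t. \<forall>k\<in>{2..K}. \<sigma> t \<ge> \<alpha> / \<mu> *
           ((deriv (\<phi> k) t + deriv (\<phi> (k - 1)) t) / (deriv (\<phi> k) t - deriv (\<phi> (k - 1)) t))"
    and "e1 > 0"
  shows
    "(threshold_cond \<mu> \<sigma> g \<alpha> \<tau>0 \<epsilon>1 \<epsilon>2 K A \<phi> e1 b \<longrightarrow>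
       (\<forall>a\<in>{scale_min \<mu> \<sigma> \<alpha> K \<phi> b .. scale_max \<mu> \<sigma> \<alpha> \<phi> b}.
          cmod (acwt \<mu> \<sigma> g (signal K A \<phi>) a b) > e1 \<longrightarrow>
          (\<exists>!k. k \<in> {1..K} \<and> (a, b) \<in> zone \<mu> \<sigma> \<alpha> \<phi> k)))
     \<and>
     (\<forall>a\<in>{scale_min \<mu> \<sigma> \<alpha> K \<phi> b .. scale_max \<mu> \<sigma> \<alpha> \<phi> b}. \<forall>k\<in>{1..K}.
        (acwt \<mu> \<sigma> g (signal K A \<phi>) a b \<noteq> 0 \<longrightarrow>
           phase_c \<mu> \<sigma> g (signal K A \<phi>) a b - complex_of_real (deriv (\<phi> k) b)
           = Rem1 \<mu> \<sigma> g K A \<phi> k a b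
             / (\<i> * complex_of_real (2 * pi) * acwt \<mu> \<sigma> g (signal K A \<phi>) a b))
        \<and>
        (cmod (acwt \<mu> \<sigma> g (signal K A \<phi>) a b) > e1 \<and> (a, b) \<in> zone \<mu> \<sigma> \<alpha> \<phi> k \<longrightarrow>
           \<bar>phase \<mu> \<sigma> g (signal K A \<phi>) a b - deriv (\<phi> k) b\<bar>
           < bd \<mu> \<sigma> g \<alpha> \<epsilon>1 \<epsilon>2 K A \<phi> e1 k b))
     \<and>
     (\<forall>k\<in>{1..K}.
        c_psi \<mu> \<sigma> g \<alpha> b \<noteq> 0 \<and>
        threshold_cond \<mu> \<sigma> g \<alpha> \<tau>0 \<epsilon>1 \<epsilon>2 K A \<phi> e1 b \<and>
        ereal (Max ((\<lambda>l. bd \<mu> \<sigma> g \<alpha> \<epsilon>1 \<epsilon>2 K A \<phi> e1 l b) ` {1..K})) \<le> freq_gap K \<phi> k b / 2 \<longrightarrow>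
        (\<forall>e3. Max ((\<lambda>l. bd \<mu> \<sigma> g \<alpha> \<epsilon>1 \<epsilon>2 K A \<phi> e1 l b) ` {1..K}) \<le> e3 \<and>
              ereal e3 \<le> freq_gap K \<phi> k b / 2 \<longrightarrow>
           (\<exists>R. ((\<lambda>lam. 1 / c_psi \<mu> \<sigma> g \<alpha> b *
                    (LBINT \<xi>:{\<xi>. \<bar>\<xi> - deriv (\<phi> k) b\<bar> < e3}.
                       awsst \<mu> \<sigma> g \<alpha> K A \<phi> h e1 lam \<xi> b)) \<longlongrightarrow> R) (at_right 0)
              \<and> cmod (R - component A \<phi> k b)
                \<le> recovery_bd \<mu> \<sigma> g \<alpha> \<epsilon>1 \<epsilon>2 K A \<phi> e1 k b)))"
proof -
  interpret wsst g \<sigma> A \<phi> K \<mu> \<alpha> \<tau>0 \<epsilon>1 \<epsilon>2 b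
    using assms by unfold_locales auto
  show ?thesis
  proof (intro conjI impI allI ballI)
    fix a
    assume "threshold_cond \<mu> \<sigma> g \<alpha> \<tau>0 \<epsilon>1 \<epsilon>2 K A \<phi> e1 b" "a \<in> {amin..amax}" "cmod (W g a) > e1"
    then show "\<exists>!k. k \<in> {1..K} \<and> (a, b) \<in> zone \<mu> \<sigma> \<alpha> \<phi> k"
      by (rule zone_exists_unique)
  next
    fix a k
    assume "a \<in> {amin..amax}" "k \<in> {1..K}" "W g a \<noteq> 0"
    then show "phase_c \<mu> \<sigma> g x a b - complex_of_real (f k)
        = Rem1 \<mu> \<sigma> g K A \<phi> k a b / (\<i> * complex_of_real (2 * pi) * W g a)"
      using amin_pos by (intro phase_c_diff) auto
  next
    fix a k
    assume "k \<in> {1..K}" "cmod (W g a) > e1 \<and> (a, b) \<in> zone \<mu> \<sigma> \<alpha> \<phi> k"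
    then show "\<bar>phase \<mu> \<sigma> g x a b - f k\<bar> < bd \<mu> \<sigma> g \<alpha> \<epsilon>1 \<epsilon>2 K A \<phi> e1 k b"
      using \<open>e1 > 0\<close> by (intro phase_error) auto
  next
    fix k e3
    assume k: "k \<in> {1..K}"
      and thr: "c_psi \<mu> \<sigma> g \<alpha> b \<noteq> 0 \<and> threshold_cond \<mu> \<sigma> g \<alpha> \<tau>0 \<epsilon>1 \<epsilon>2 K A \<phi> e1 b \<and>
        ereal (Max ((\<lambda>l. bd \<mu> \<sigma> g \<alpha> \<epsilon>1 \<epsilon>2 K A \<phi> e1 l b) ` {1..K})) \<le> freq_gap K \<phi> k b / 2"
      and e3: "Max ((\<lambda>l. bd \<mu> \<sigma> g \<alpha> \<epsilon>1 \<epsilon>2 K A \<phi> e1 l b) ` {1..K}) \<le> e3 \<and>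
        ereal e3 \<le> freq_gap K \<phi> k b / 2"
    have "bd \<mu> \<sigma> g \<alpha> \<epsilon>1 \<epsilon>2 K A \<phi> e1 l b \<le> e3" if "l \<in> {1..K}" for l
      by (rule order_trans[OF Max_ge conjunct1[OF e3]]) (use that in auto)
    then show "\<exists>R. ((\<lambda>lam. 1 / c_psi \<mu> \<sigma> g \<alpha> b *
        (LBINT \<xi>:{\<xi>. \<bar>\<xi> - f k\<bar> < e3}. awsst \<mu> \<sigma> g \<alpha> K A \<phi> h e1 lam \<xi> b)) \<longlongrightarrow> R) (at_right 0)
      \<and> cmod (R - xc k) \<le> recovery_bd \<mu> \<sigma> g \<alpha> \<epsilon>1 \<epsilon>2 K A \<phi> e1 k b"
      using thr e3 assms(6-8) k \<open>e1 > 0\<close> by (intro recovery) auto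
  qed
qed

end
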